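(* Define vectors $(a_i,b_i,c_i)$, $i\ge0$, of formal power series in $x$ by $(a_0,b_0,c_0)=(tx,x^2,x)$ and, for $i>0$, $a_i=tx\exp(a_{i-1}+b_{i-1})\cosh(c_{i-1})$, $b_i=x\exp(a_{i-1}+b_{i-1})\sinh(c_{i-1})$, $c_i=x\exp(t^{-1}a_{i-1}+tb_{i-1}+c_{i-1})$. Then $(a_i,b_i,c_i)$ converges (coefficientwise) to a vector $(a_\infty,b_\infty,c_\infty)$ of formal power series in $x$ with coefficients in $\mathbb{Q}[t]$, and $\mathscr T_w^+=a_\infty$, $\mathscr T_w^-=b_\infty$, $\mathscr T_b=c_\infty$, $\mathscr T=a_\infty+b_\infty+c_\infty$.
   Context: A rooted tree is a finite tree with a distinguished root; $\operatorname{Aut}T$ denotes root-preserving automorphisms, and sums over rooted trees are over isomorphism classes. A coloring of $T$ is a map $c\colon V(T)\to\{0,1\}$ ($0$ white, $1$ black); a vertex is even-white if it is white with an even number of black neighbors; the black-white polynomial is $W_T(t)=\sum_c t^{\#\{\text{even-white vertices}\}}$. Let $\mathscr T(x)=\sum_T W_T(t)x^{v(T)}/|\operatorname{Aut}T|$, where $v(T)$ is the number of vertices. Decompose $\mathscr T=\mathscr T_w^++\mathscr T_w^-+\mathscr T_b$, where $\mathscr T_w^+$ (resp. $\mathscr T_w^-$, $\mathscr T_b$) is $\sum_{(T,c)}t^{\#\{\text{even-white vertices of }c\}}x^{v(T)}/|\operatorname{Aut}T|$ summed over rooted trees $T$ and colorings $c$ in which the root is white with an even number of black children (resp. the root is white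 with an odd number of black children; resp. the root is black). *)

theory Defs
  imports
    "HOL-Computational_Algebra.Computational_Algebra"
    "HOL-Combinatorics.Permutations"
    "HOL-Library.FuncSet"
begin

section \<open>Rooted trees\<close>

record 'a rooted_graph =
  verts :: "'a set"
  adj :: "('a \<times> 'a) set"
  rootv :: 'a

definition graph_cycle :: "('a \<times> 'a) set \<Rightarrow> 'a list \<Rightarrow> bool" where
  "graph_cycle E p \<longleftrightarrow> 3 \<le> length p \<and> distinct p \<and>
     (\<forall>i<length p. (p ! i, p ! (Suc i mod length p)) \<in> E)"

text \<open>A rooted tree is a finite connected simple graph without cycles, with a distinguished
  vertex; simple graphs are encoded by their symmetric irreflexive adjacency relation.\<close>

definition rooted_tree :: "'a rooted_graph \<Rightarrow> bool" where
  "rooted_tree T \<longleftrightarrow>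
     finite (verts T) \<and> rootv T \<in> verts T \<and>
     adj T \<subseteq> verts T \<times> verts T \<and> sym (adj T) \<and> irrefl (adj T) \<and>
     (\<forall>u\<in>verts T. \<forall>v\<in>verts T. (u, v) \<in> (adj T)\<^sup>*) \<and>
     \<not> (\<exists>p. graph_cycle (adj T) p)"

definition rooted_iso :: "('a \<Rightarrow> 'b) \<Rightarrow> 'a rooted_graph \<Rightarrow> 'b rooted_graph \<Rightarrow> bool" where
  "rooted_iso f S T \<longleftrightarrow>
     bij_betw f (verts S) (verts T) \<and> f (rootv S) = rootv T \<and>
     (\<forall>u\<in>verts S. \<forall>v\<in>verts S. (u, v) \<in> adj S \<longleftrightarrow> (f u, f v) \<in> adj T)"

text \<open>Automorphisms are extended by the identity outside the vertex set, so that distinct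
  elements of this set are distinct maps on the vertices.\<close>

definition rooted_auts :: "'a rooted_graph \<Rightarrow> ('a \<Rightarrow> 'a) set" where
  "rooted_auts T = {f. f permutes verts T \<and> rooted_iso f T T}"

text \<open>Every rooted tree with \<open>n\<close> vertices is isomorphic to one with vertex set \<open>{..<n}\<close>, so the
  isomorphism classes of rooted trees with \<open>n\<close> vertices are taken within those.\<close>

definition rooted_trees :: "nat \<Rightarrow> nat rooted_graph set" where
  "rooted_trees n = {T. rooted_tree T \<and> verts T = {..<n}}"

definition rooted_iso_rel :: "nat \<Rightarrow> (nat rooted_graph \<times> nat rooted_graph) set" where
  "rooted_iso_rel n =
     {(S, T). S \<in> rooted_trees n \<and> T \<in> rooted_trees n \<and> (\<exists>f. rooted_iso f S T)}"

definition rooted_tree_classes :: "nat \<Rightarrow> nat rooted_graph set set" where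
  "rooted_tree_classes n = rooted_trees n // rooted_iso_rel n"

lemma finite_rooted_trees: "finite (rooted_trees n)"
proof (rule finite_subset)
  show "rooted_trees n \<subseteq> (\<lambda>(E, r). \<lparr>verts = {..<n}, adj = E, rootv = r\<rparr>) `
          (Pow ({..<n} \<times> {..<n}) \<times> {..<n})"
  proof
    fix T assume T: "T \<in> rooted_trees n"
    have "T = \<lparr>verts = {..<n}, adj = adj T, rootv = rootv T\<rparr>"
      using T by (simp add: rooted_trees_def)
    moreover have "(adj T, rootv T) \<in> Pow ({..<n} \<times> {..<n}) \<times> {..<n}"
      using T by (auto simp: rooted_trees_def rooted_tree_def)
    ultimately show "T \<in> (\<lambda>(E, r). \<lparr>verts = {..<n}, adj = E, rootv = r\<rparr>) `
          (Pow ({..<n} \<times> {..<n}) \<times> {..<n})"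
      by (metis (mono_tags, lifting) case_prod_conv image_eqI)
  qed
qed simp

lemma finite_rooted_tree_classes: "finite (rooted_tree_classes n)"
  unfolding rooted_tree_classes_def
  by (rule finite_quotient) (auto simp: finite_rooted_trees rooted_iso_rel_def)

lemma equiv_rooted_iso_rel: "equiv (rooted_trees n) (rooted_iso_rel n)"
proof (rule equivI)
  show "rooted_iso_rel n \<subseteq> rooted_trees n \<times> rooted_trees n"
    by (auto simp: rooted_iso_rel_def)
  show "refl_on (rooted_trees n) (rooted_iso_rel n)"
    by (auto simp: refl_on_def rooted_iso_rel_def rooted_iso_def intro!: exI[of _ id])
  show "sym (rooted_iso_rel n)"
  proof (rule symI)
    fix S T assume "(S, T) \<in> rooted_iso_rel n"
    then obtain f where ST: "S \<in> rooted_trees n" "T \<in> rooted_trees n" and f: "rooted_iso f S T"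
      by (auto simp: rooted_iso_rel_def)
    have r: "rootv S \<in> verts S"
      using ST(1) unfolding rooted_trees_def rooted_tree_def by blast
    have b: "bij_betw f (verts S) (verts T)"
      using f by (simp add: rooted_iso_def)
    let ?g = "inv_into (verts S) f"
    have g: "?g v \<in> verts S" "f (?g v) = v" if "v \<in> verts T" for v
      using that b bij_betw_inv_into_right[OF b] bij_betwE[OF bij_betw_inv_into[OF b]] by auto
    have "rooted_iso ?g T S"
      using f g r bij_betw_inv_into[OF b] bij_betw_inv_into_left[OF b r]
      by (simp add: rooted_iso_def)
    then show "(T, S) \<in> rooted_iso_rel n"
      using ST by (auto simp: rooted_iso_rel_def)
  qed
  show "trans (rooted_iso_rel n)"
  proof (rule transI)
    fix S T U assume "(S, T) \<in> rooted_iso_rel n" "(T, U) \<in> rooted_iso_rel n"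
    then obtain f g where m: "S \<in> rooted_trees n" "U \<in> rooted_trees n"
      and f: "rooted_iso f S T" and g: "rooted_iso g T U"
      by (auto simp: rooted_iso_rel_def)
    have b: "bij_betw f (verts S) (verts T)" using f by (simp add: rooted_iso_def)
    have "rooted_iso (g \<circ> f) S U"
      using f g bij_betwE[OF b] by (auto simp: rooted_iso_def intro: bij_betw_trans)
    then show "(S, U) \<in> rooted_iso_rel n"
      using m by (auto simp: rooted_iso_rel_def)
  qed
qed

text \<open>\<open>tree_sum f\<close> is the generating function of \<open>f T / |Aut T|\<close>, one term for each isomorphism
  class; it is meant for \<open>f\<close> invariant under isomorphism.\<close>

definition tree_sum :: "(nat rooted_graph \<Rightarrow> rat poly) \<Rightarrow> rat poly fps" where
  "tree_sum f = Abs_fps (\<lambda>n. \<Sum>X\<in>rooted_tree_classes n.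
     let T = (SOME T. T \<in> X) in smult (1 / of_nat (card (rooted_auts T))) (f T))"


section \<open>Colorings and the black-white polynomial\<close>

definition colorings :: "'a rooted_graph \<Rightarrow> ('a \<Rightarrow> nat) set" where
  "colorings T = verts T \<rightarrow>\<^sub>E {0, 1}"

definition black_nbrs :: "'a rooted_graph \<Rightarrow> ('a \<Rightarrow> nat) \<Rightarrow> 'a \<Rightarrow> 'a set" where
  "black_nbrs T c v = {u \<in> verts T. (v, u) \<in> adj T \<and> c u = 1}"

definition even_white :: "'a rooted_graph \<Rightarrow> ('a \<Rightarrow> nat) \<Rightarrow> 'a set" where
  "even_white T c = {v \<in> verts T. c v = 0 \<and> even (card (black_nbrs T c v))}"

definition coloring_weight :: "'a rooted_graph \<Rightarrow> ('a \<Rightarrow> nat) \<Rightarrow> rat poly" where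
  "coloring_weight T c = monom 1 (card (even_white T c))"

definition bw_poly :: "'a rooted_graph \<Rightarrow> rat poly" where
  "bw_poly T = (\<Sum>c\<in>colorings T. coloring_weight T c)"

definition tree_series :: "rat poly fps" where
  "tree_series = tree_sum bw_poly"

text \<open>The children of the root are its neighbors.\<close>

definition tree_series_w_plus :: "rat poly fps" where
  "tree_series_w_plus = tree_sum (\<lambda>T.
     \<Sum>c\<in>{c \<in> colorings T. c (rootv T) = 0 \<and> even (card (black_nbrs T c (rootv T)))}.
       coloring_weight T c)"

definition tree_series_w_minus :: "rat poly fps" where
  "tree_series_w_minus = tree_sum (\<lambda>T.
     \<Sum>c\<in>{c \<in> colorings T. c (rootv T) = 0 \<and> odd (card (black_nbrs T c (rootv T)))}.
       coloring_weight T c)"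

definition tree_series_b :: "rat poly fps" where
  "tree_series_b = tree_sum (\<lambda>T.
     \<Sum>c\<in>{c \<in> colorings T. c (rootv T) = 1}. coloring_weight T c)"


section \<open>Exponential and hyperbolic functions of formal power series\<close>

text \<open>These are the intended functions only for arguments \<open>f\<close> without constant term, which is the
  only case in which composition of formal power series is meaningful.\<close>

definition fps_Exp :: "'a::field_char_0 fps \<Rightarrow> 'a fps" where
  "fps_Exp f = fps_compose (fps_exp 1) f"

definition fps_Cosh :: "'a::field_char_0 fps \<Rightarrow> 'a fps" where
  "fps_Cosh f = fps_const (1/2) * (fps_Exp f + fps_Exp (- f))"

definition fps_Sinh :: "'a::field_char_0 fps \<Rightarrow> 'a fps" where
  "fps_Sinh f = fps_const (1/2) * (fps_Exp f - fps_Exp (- f))"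

text \<open>The recursion involves the inverse of \<open>t\<close>, so it takes place over the field of rational
  functions in \<open>t\<close>, into which the polynomials embed by \<^const>\<open>to_fract\<close>.\<close>

definition tvar :: "rat poly fract" where
  "tvar = to_fract (monom 1 1)"

end

theory Submission
  imports Defs
begin

text \<open>Each \<open>tree_sum\<close> is the exponential generating function of labelled rooted trees. Fix a root \<open>r\<close>
  and another vertex \<open>m\<close>: cutting the edge at \<open>r\<close> towards \<open>m\<close> splits a colored tree into a smaller tree
  with the same root and the branch containing \<open>m\<close>. The coloring weight without the root factor, with
  a sign recording the parity of black neighbours of the root, is multiplicative under this splitting,
  which gives \<open>G' = H' G\<close> and hence \<open>G = exp H\<close>. A branch root whose parent is black changes its parity,
  so it contributes \<open>t\<^sup>-\<^sup>1 a + t b + c\<close> to \<open>H\<close>; below a white parent it contributes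
  \<open>a + b \<plusminus> c\<close>. Thus the three series form a fixed point of the recursion, which is a contraction.\<close>

section \<open>Exponentials of formal power series\<close>

text \<open>The branches at the root form an unordered family, and the parity of the number of black
  branch roots couples them. Marking a second label \<open>m\<close> avoids handling the family as a
  whole: it singles out one branch, which is the combinatorial meaning of differentiating an
  exponential, so the exponential formula only needs the equation y' = f' y. The coupling disappears
  because -1 to the number of black children is a product over the branches; half the sum and half
  the difference of the values at \<sigma> = 1 and \<sigma> = -1 are what turn exp into cosh and
  sinh. A last obstacle is that splitting produces arbitrary label sets and roots. Weighted sums are
  therefore taken over any finite label set with any root in it, and that only the number of labels
  matters comes out of the recursion itself. The counting is done for an element \<open>t\<close> of
  any field of characteristic 0 and specialised to \<open>tvar\<close> at the end.\<close>

text \<open>Coefficient m of the equation expresses m + 1 times coefficient m + 1 of the solution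
  through lower ones, and characteristic 0 allows division by m + 1.\<close>

lemma fps_linear_ode_unique:
  fixes F G D :: "'a::field_char_0 fps"
  assumes "fps_deriv F = D * F" "fps_deriv G = D * G" "F $ 0 = G $ 0"
  shows "F = G"
proof (rule fps_ext)
  fix n show "F $ n = G $ n"
  proof (induction n rule: less_induct)
    case (less n)
    show ?case
    proof (cases n)
      case (Suc m)
      have "of_nat (Suc m) * F $ Suc m = (\<Sum>i=0..m. D $ i * F $ (m - i))"
        using arg_cong[OF assms(1), of "\<lambda>f. f $ m"] by (simp add: fps_mult_nth)
      also have "\<dots> = (\<Sum>i=0..m. D $ i * G $ (m - i))"
        using less Suc by (intro sum.cong) auto
      also have "\<dots> = of_nat (Suc m) * G $ Suc m"
        using arg_cong[OF assms(2), of "\<lambda>f. f $ m"] by (simp add: fps_mult_nth)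
      finally show ?thesis using Suc by (simp del: of_nat_Suc)
    qed (use assms in simp)
  qed
qed

lemma fps_Exp_nth_0 [simp]: "fps_Exp f $ 0 = 1"
  by (simp add: fps_Exp_def)

lemma fps_Exp_deriv:
  assumes "f $ 0 = 0"
  shows "fps_deriv (fps_Exp f) = fps_deriv f * fps_Exp f"
  using assms by (simp add: fps_Exp_def fps_compose_deriv)

lemma fps_Exp_eqI:
  assumes "f $ 0 = 0" "fps_deriv F = fps_deriv f * F" "F $ 0 = 1"
  shows "F = fps_Exp f"
  by (rule fps_linear_ode_unique[OF assms(2) fps_Exp_deriv[OF assms(1)]]) (simp add: assms)

text \<open>By the product rule, the right side solves the differential equation that characterizes
  the left side.\<close>

lemma fps_Exp_add:
  assumes "f $ 0 = 0" "g $ 0 = 0"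
  shows "fps_Exp (f + g) = fps_Exp f * fps_Exp g"
  by (rule fps_Exp_eqI[symmetric]) (use assms in \<open>simp_all add: fps_Exp_deriv algebra_simps\<close>)

lemma fps_Exp_mult_Cosh:
  assumes "f $ 0 = 0" "g $ 0 = 0"
  shows "fps_Exp f * fps_Cosh g = fps_const (1/2) * (fps_Exp (f + g) + fps_Exp (f - g))"
  using fps_Exp_add[OF assms] fps_Exp_add[of f "- g"] assms
  by (simp add: fps_Cosh_def algebra_simps)

lemma fps_Exp_mult_Sinh:
  assumes "f $ 0 = 0" "g $ 0 = 0"
  shows "fps_Exp f * fps_Sinh g = fps_const (1/2) * (fps_Exp (f + g) - fps_Exp (f - g))"
  using fps_Exp_add[OF assms] fps_Exp_add[of f "- g"] assms
  by (simp add: fps_Sinh_def algebra_simps)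

section \<open>Congruence modulo powers of \<open>x\<close> and convergence of the recursion\<close>

definition fps_agree :: "nat \<Rightarrow> 'a fps \<Rightarrow> 'a fps \<Rightarrow> bool" where
  "fps_agree n f g \<longleftrightarrow> (\<forall>k<n. f $ k = g $ k)"

lemma fps_agree_refl [simp]: "fps_agree n f f"
  by (simp add: fps_agree_def)

lemma fps_agree_add: "fps_agree n f g \<Longrightarrow> fps_agree n f' g' \<Longrightarrow> fps_agree n (f + f') (g + g')"
  by (simp add: fps_agree_def)

lemma fps_agree_diff:
  fixes f :: "'a::ab_group_add fps"
  shows "fps_agree n f g \<Longrightarrow> fps_agree n f' g' \<Longrightarrow> fps_agree n (f - f') (g - g')"
  by (simp add: fps_agree_def)

lemma fps_agree_uminus:
  fixes f :: "'a::ab_group_add fps"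
  shows "fps_agree n f g \<Longrightarrow> fps_agree n (- f) (- g)"
  by (simp add: fps_agree_def)

lemma fps_agree_mult:
  assumes "fps_agree n f g" "fps_agree n f' g'"
  shows "fps_agree n (f * f') (g * g')"
  using assms by (auto simp: fps_agree_def fps_mult_nth intro!: sum.cong)

lemma fps_agree_power: "fps_agree n f g \<Longrightarrow> fps_agree n (f ^ k) (g ^ k)"
  by (induction k) (auto intro: fps_agree_mult)

text \<open>Coefficient k of a composition is a finite combination of the k-th coefficients of the
  powers of the inner series.\<close>

lemma fps_agree_Exp: "fps_agree n f g \<Longrightarrow> fps_agree n (fps_Exp f) (fps_Exp g)"
  using fps_agree_power[of n f g]
  by (auto simp: fps_agree_def fps_Exp_def fps_compose_nth intro!: sum.cong)

lemma fps_agree_Cosh: "fps_agree n f g \<Longrightarrow> fps_agree n (fps_Cosh f) (fps_Cosh g)"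
  unfolding fps_Cosh_def
  by (intro fps_agree_mult fps_agree_add fps_agree_Exp fps_agree_uminus fps_agree_refl)

lemma fps_agree_Sinh: "fps_agree n f g \<Longrightarrow> fps_agree n (fps_Sinh f) (fps_Sinh g)"
  unfolding fps_Sinh_def
  by (intro fps_agree_mult fps_agree_diff fps_agree_Exp fps_agree_uminus fps_agree_refl)

lemma fps_agree_X_mult:
  fixes f g :: "'a::semiring_1 fps"
  assumes "fps_agree n f g"
  shows "fps_agree (Suc n) (fps_X * f) (fps_X * g)"
  using assms by (auto simp: fps_agree_def fps_X_mult_nth)

text \<open>Since every right-hand side carries a factor \<open>x\<close>, each step of the recursion gains one
  correct coefficient, whatever the starting vector.\<close>

lemma tree_recursion_converges:
  fixes a b c :: "nat \<Rightarrow> 'a::field_char_0 fps"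
  assumes a_step: "\<And>i. i > 0 \<Longrightarrow>
      a i = fps_const s * fps_X * fps_Exp (a (i - 1) + b (i - 1)) * fps_Cosh (c (i - 1))"
    and b_step: "\<And>i. i > 0 \<Longrightarrow>
      b i = fps_X * fps_Exp (a (i - 1) + b (i - 1)) * fps_Sinh (c (i - 1))"
    and c_step: "\<And>i. i > 0 \<Longrightarrow>
      c i = fps_X * fps_Exp (fps_const (inverse s) * a (i - 1)
              + fps_const s * b (i - 1) + c (i - 1))"
    and A: "A = fps_const s * fps_X * fps_Exp (A + B) * fps_Cosh C"
    and B: "B = fps_X * fps_Exp (A + B) * fps_Sinh C"
    and C: "C = fps_X * fps_Exp (fps_const (inverse s) * A + fps_const s * B + C)"
  shows "fps_agree i (a i) A \<and> fps_agree i (b i) B \<and> fps_agree i (c i) C"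
proof (induction i)
  case 0
  show ?case by (simp add: fps_agree_def)
next
  case (Suc i)
  then have IH: "fps_agree i (a i) A" "fps_agree i (b i) B" "fps_agree i (c i) C"
    by auto
  \<comment> \<open>\<open>fps_X\<close> is moved to the front, since this factor is what raises the
    order of agreement from \<open>i\<close> to \<open>Suc i\<close>.\<close>
  have "fps_agree (Suc i) (fps_X * (fps_const s * (fps_Exp (a i + b i) * fps_Cosh (c i))))
      (fps_X * (fps_const s * (fps_Exp (A + B) * fps_Cosh C)))"
    by (intro fps_agree_X_mult fps_agree_mult fps_agree_add fps_agree_Exp fps_agree_Cosh
        fps_agree_refl IH)
  moreover have "fps_agree (Suc i) (fps_X * (fps_Exp (a i + b i) * fps_Sinh (c i)))
      (fps_X * (fps_Exp (A + B) * fps_Sinh C))"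
    by (intro fps_agree_X_mult fps_agree_mult fps_agree_add fps_agree_Exp fps_agree_Sinh
        fps_agree_refl IH)
  moreover have "fps_agree (Suc i)
      (fps_X * fps_Exp (fps_const (inverse s) * a i + fps_const s * b i + c i))
      (fps_X * fps_Exp (fps_const (inverse s) * A + fps_const s * B + C))"
    by (intro fps_agree_X_mult fps_agree_mult fps_agree_add fps_agree_Exp fps_agree_refl IH)
  ultimately show ?case
    using a_step[of "Suc i"] b_step[of "Suc i"] c_step[of "Suc i"] A B C
    by (simp add: mult_ac)
qed

section \<open>From a binomial recursion to an exponential\<close>

lemma sum_Pow_card:
  fixes f :: "nat \<Rightarrow> 'a::comm_semiring_1"
  assumes "finite B"
  shows "(\<Sum>S\<in>Pow B. f (card S)) = (\<Sum>k\<le>card B. of_nat (card B choose k) * f k)"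
proof -
  have "(\<Sum>S\<in>Pow B. f (card S)) = (\<Sum>k\<le>card B. \<Sum>S\<in>{S \<in> Pow B. card S = k}. f (card S))"
    using assms by (intro sum.group[symmetric]) (auto intro: card_mono)
  also have "\<dots> = (\<Sum>k\<le>card B. of_nat (card B choose k) * f k)"
    using n_subsets[OF assms] by (intro sum.cong) auto
  finally show ?thesis .
qed

text \<open>The recursion says that the exponential generating function satisfies \<open>G' = H' G\<close>, where
  \<open>H = x \<Sum> l\<^sub>k x\<^sup>k / k!\<close>.\<close>

lemma egf_eq_Exp:
  fixes g l :: "nat \<Rightarrow> 'a::field_char_0"
  assumes "g 0 = 1"
    and "\<And>n. g (Suc n) = (\<Sum>k\<le>n. of_nat (n choose k) * (of_nat (Suc k) * l k * g (n - k)))"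
  shows "Abs_fps (\<lambda>n. g n / fact n) = fps_Exp (fps_X * Abs_fps (\<lambda>n. l n / fact n))"
proof (rule fps_Exp_eqI)
  show "fps_deriv (Abs_fps (\<lambda>n. g n / fact n)) =
      fps_deriv (fps_X * Abs_fps (\<lambda>n. l n / fact n)) * Abs_fps (\<lambda>n. g n / fact n)"
  proof (rule fps_ext)
    fix n
    have "fps_deriv (Abs_fps (\<lambda>n. g n / fact n)) $ n = g (Suc n) / fact n"
      by (simp add: field_simps del: of_nat_Suc)
    also have "\<dots> = (\<Sum>k\<le>n. of_nat (Suc k) * (l k / fact k) * (g (n - k) / fact (n - k)))"
      unfolding assms(2) sum_divide_distrib
      by (intro sum.cong refl) (simp add: binomial_fact del: of_nat_Suc)
    also have "\<dots> = (fps_deriv (fps_X * Abs_fps (\<lambda>n. l n / fact n)) *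
        Abs_fps (\<lambda>n. g n / fact n)) $ n"
      unfolding fps_mult_nth atLeast0AtMost by (intro sum.cong refl) (simp add: field_simps)
    finally show "fps_deriv (Abs_fps (\<lambda>n. g n / fact n)) $ n =
      (fps_deriv (fps_X * Abs_fps (\<lambda>n. l n / fact n)) * Abs_fps (\<lambda>n. g n / fact n)) $ n" .
  qed
qed (use assms in simp_all)

section \<open>Splitting a rooted tree at a branch\<close>

lemma simple_path_exists:
  assumes "(u, v) \<in> R\<^sup>*"
  obtains p where "p \<noteq> []" "hd p = u" "last p = v" "distinct p"
    "\<And>i. Suc i < length p \<Longrightarrow> (p ! i, p ! Suc i) \<in> R"
proof -
  have "\<exists>p. p \<noteq> [] \<and> hd p = u \<and> last p = v \<and> distinct p \<and>
      (\<forall>i. Suc i < length p \<longrightarrow> (p ! i, p ! Suc i) \<in> R)"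
    using assms
  proof (induction rule: rtrancl_induct)
    case base
    show ?case by (intro exI[of _ "[u]"]) simp
  next
    case (step y z)
    then obtain p where p: "p \<noteq> []" "hd p = u" "last p = y" "distinct p"
      "\<forall>i. Suc i < length p \<longrightarrow> (p ! i, p ! Suc i) \<in> R" by blast
    show ?case
    proof (cases "z \<in> set p")
      \<comment> \<open>A revisited vertex: cutting the path back to its earlier occurrence keeps
        the vertices distinct.\<close>
      case True
      then obtain k where k: "k < length p" "p ! k = z" by (auto simp: in_set_conv_nth)
      have "last (take (Suc k) p) = z"
        using k by (simp add: take_Suc_conv_app_nth)
      then show ?thesis using p k
        by (intro exI[of _ "take (Suc k) p"]) (auto simp: hd_take)
    next
      case False
      have "((p @ [z]) ! i, (p @ [z]) ! Suc i) \<in> R" if "Suc i < length (p @ [z])" for i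
      proof (cases "Suc i < length p")
        case True then show ?thesis using p by (simp add: nth_append)
      next
        case F: False
        then have "i = length p - 1" "Suc i = length p" using that p(1) by auto
        then show ?thesis using p step by (simp add: nth_append last_conv_nth)
      qed
      then show ?thesis using p False
        by (intro exI[of _ "p @ [z]"]) auto
    qed
  qed
  then show thesis using that by blast
qed

text \<open>A path avoiding \<open>r\<close> between two distinct neighbours of \<open>r\<close> closes up to a cycle.\<close>

lemma acyclic_neighbour_unique:
  assumes acyc: "\<not> (\<exists>p. graph_cycle E p)" and "sym E"
    and "(r, v) \<in> E" "(r, w) \<in> E" and path: "(v, w) \<in> (E \<inter> (- {r}) \<times> (- {r}))\<^sup>*"
    and "v \<noteq> r"
  shows "v = w"
proof (rule ccontr)
  assume "v \<noteq> w"
  obtain p where p: "p \<noteq> []" "hd p = v" "last p = w" "distinct p"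
    "\<And>i. Suc i < length p \<Longrightarrow> (p ! i, p ! Suc i) \<in> E \<inter> (- {r}) \<times> (- {r})"
    using simple_path_exists[OF path] by metis
  have len: "2 \<le> length p"
  proof (rule ccontr)
    assume "\<not> 2 \<le> length p"
    then obtain x where "p = [x]" using p(1) by (cases p; cases "tl p") auto
    then show False using p \<open>v \<noteq> w\<close> by simp
  qed
  have nr: "r \<notin> set p"
  proof
    assume "r \<in> set p"
    then obtain k where k: "k < length p" "p ! k = r" by (auto simp: in_set_conv_nth)
    \<comment> \<open>Every later vertex is the target of a step that avoids \<open>r\<close>; only
      the head needs the separate assumption on \<open>v\<close>.\<close>
    have "k \<noteq> 0" using k p \<open>v \<noteq> r\<close> by (metis hd_conv_nth)
    then have "Suc (k - 1) < length p" "Suc (k - 1) = k" using k by auto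
    then show False using p(5)[of "k - 1"] k by auto
  qed
  have "graph_cycle E (r # p)"
    unfolding graph_cycle_def
  proof (intro conjI allI impI)
    show "3 \<le> length (r # p)" "distinct (r # p)" using len nr p by auto
    fix i assume i: "i < length (r # p)"
    \<comment> \<open>The edge from \<open>r\<close> to the start of the path, an inner edge of the
      path, and the edge closing the cycle back to \<open>r\<close>.\<close>
    consider "i = 0" | j where "i = Suc j" "Suc j < length p" | "i = length p" using i
      by (metis Suc_lessI length_Cons not0_implies_Suc Suc_less_eq)
    then show "((r # p) ! i, (r # p) ! (Suc i mod length (r # p))) \<in> E"
    proof cases
      case 1
      then show ?thesis using len p(1,2) \<open>(r, v) \<in> E\<close> by (simp add: hd_conv_nth)
    next
      case 2
      then show ?thesis using p(5)[of j] by simp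
    next
      case 3
      then show ?thesis using p(1,3) \<open>(r, w) \<in> E\<close> \<open>sym E\<close>
        by (simp add: last_conv_nth nth_Cons' symD)
    qed
  qed
  then show False using acyc by blast
qed

section \<open>Hanging a branch below the root and cutting it off again\<close>

definition join :: "'a rooted_graph \<Rightarrow> 'a rooted_graph \<Rightarrow> 'a rooted_graph" where
  "join T U = \<lparr>verts = verts T \<union> verts U,
     adj = adj T \<union> adj U \<union> {(rootv T, rootv U), (rootv U, rootv T)}, rootv = rootv T\<rparr>"

lemma join_simps [simp]:
  "verts (join T U) = verts T \<union> verts U"
  "adj (join T U) = adj T \<union> adj U \<union> {(rootv T, rootv U), (rootv U, rootv T)}"
  "rootv (join T U) = rootv T"
  by (simp_all add: join_def)

lemma rooted_treeD:
  assumes "rooted_tree T"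
  shows "finite (verts T)" "rootv T \<in> verts T" "adj T \<subseteq> verts T \<times> verts T" "sym (adj T)"
    "irrefl (adj T)" "u \<in> verts T \<Longrightarrow> v \<in> verts T \<Longrightarrow> (u, v) \<in> (adj T)\<^sup>*"
    "\<not> (\<exists>p. graph_cycle (adj T) p)"
  using assms by (auto simp: rooted_tree_def)

text \<open>Otherwise \<open>P\<close> would propagate from \<open>i\<close> around the whole cycle
  and reach \<open>j\<close>.\<close>

lemma cyclic_step_exists:
  assumes "i < n" "P i" "j < n" "\<not> P j"
  shows "\<exists>k<n. P k \<and> \<not> P (Suc k mod n)"
proof (rule ccontr)
  assume *: "\<not> ?thesis"
  have "P ((i + k) mod n)" for k
  proof (induction k)
    case 0 then show ?case using assms by simp
  next
    case (Suc k)
    have "(i + k) mod n < n" using assms by simp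
    then have "P (Suc ((i + k) mod n) mod n)" using * Suc by blast
    then show ?case by (simp add: mod_Suc_eq)
  qed
  \<comment> \<open>This offset leads from \<open>i\<close> to \<open>j\<close> modulo
    \<open>n\<close>; adding \<open>n\<close> first avoids truncated subtraction.\<close>
  from this[of "j + n - i"] show False using assms by simp
qed

text \<open>A cycle meeting both parts would have to cross the only connecting edge twice, in opposite
  directions; as its vertices are distinct, it would have length two.\<close>

lemma no_cycle_join:
  assumes T: "rooted_tree T" and U: "rooted_tree U" and disj: "verts T \<inter> verts U = {}"
  shows "\<not> graph_cycle (adj (join T U)) p"
proof
  assume c: "graph_cycle (adj (join T U)) p"
  let ?n = "length p" and ?s = "\<lambda>i. Suc i mod length p"
  note TD = rooted_treeD[OF T] and UD = rooted_treeD[OF U]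
  have n: "3 \<le> ?n" and d: "distinct p" and e: "\<And>i. i < ?n \<Longrightarrow> (p ! i, p ! ?s i) \<in> adj (join T U)"
    using c by (auto simp: graph_cycle_def)
  have s: "?s i < ?n" for i using n by (intro mod_less_divisor) linarith
  have V: "p ! i \<in> verts T \<union> verts U" if "i < ?n" for i
    using e[OF that] TD(2,3) UD(2,3) by auto
  have cross1: "p ! i = rootv T \<and> p ! ?s i = rootv U"
    if "i < ?n" "p ! i \<in> verts T" "p ! ?s i \<notin> verts T" for i
    using e[OF that(1)] that TD(2,3) UD(2,3) disj by auto
  have cross2: "p ! i = rootv U \<and> p ! ?s i = rootv T"
    if "i < ?n" "p ! i \<notin> verts T" "p ! ?s i \<in> verts T" for i
    using e[OF that(1)] that TD(2,3) UD(2,3) disj by auto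
  consider "\<forall>i<?n. p ! i \<in> verts T" | "\<forall>i<?n. p ! i \<notin> verts T"
    | i j where "i < ?n" "p ! i \<in> verts T" "j < ?n" "p ! j \<notin> verts T" by blast
  then show False
  proof cases
    case 1
    have "(p ! i, p ! ?s i) \<in> adj T" if "i < ?n" for i
    proof -
      have "p ! i \<in> verts T" "p ! ?s i \<in> verts T" using 1 s that by blast+
      then show ?thesis using e[OF that] UD(2,3) disj by auto
    qed
    then show False using n d TD(7) unfolding graph_cycle_def by blast
  next
    case 2
    have "(p ! i, p ! ?s i) \<in> adj U" if "i < ?n" for i
    proof -
      have "p ! i \<notin> verts T" "p ! ?s i \<notin> verts T" using 2 s that by blast+
      then show ?thesis using e[OF that] TD(2,3) by auto
    qed
    then show False using n d UD(7) unfolding graph_cycle_def by blast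
  next
    case 3
    obtain k where k: "k < ?n" "p ! k \<in> verts T" "p ! ?s k \<notin> verts T"
      using cyclic_step_exists[of i ?n "\<lambda>i. p ! i \<in> verts T" j] 3 by blast
    obtain l where l: "l < ?n" "p ! l \<notin> verts T" "p ! ?s l \<in> verts T"
      using cyclic_step_exists[of j ?n "\<lambda>i. p ! i \<notin> verts T" i] 3 by blast
    have "p ! l = p ! ?s k" "p ! k = p ! ?s l"
      using cross1[OF k] cross2[OF l] by simp_all
    then have "l = ?s k" "k = ?s l"
      using k(1) l(1) s d by (simp_all only: nth_eq_iff_index_eq)
    \<comment> \<open>Crossing over and back returns to position \<open>k\<close> after two steps,
      which a cycle of length at least 3 excludes.\<close>
    then have "k = Suc (Suc k) mod ?n" by (metis mod_Suc_eq)
    moreover have "Suc (Suc k) mod ?n \<noteq> k"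
      using n k(1) by (cases "Suc (Suc k) < ?n") (auto simp: mod_if)
    ultimately show False by simp
  qed
qed

lemma rooted_tree_join:
  assumes T: "rooted_tree T" and U: "rooted_tree U" and disj: "verts T \<inter> verts U = {}"
  shows "rooted_tree (join T U)"
proof -
  note TD = rooted_treeD[OF T] and UD = rooted_treeD[OF U]
  let ?E = "adj (join T U)"
  have sub: "(adj T)\<^sup>* \<subseteq> ?E\<^sup>*" "(adj U)\<^sup>* \<subseteq> ?E\<^sup>*"
    by (auto intro!: rtrancl_mono)
  have symE: "sym ?E" using TD(4) UD(4) by (auto simp: sym_def)
  have root: "(u, rootv T) \<in> ?E\<^sup>*" if "u \<in> verts T \<union> verts U" for u
  proof (cases "u \<in> verts T")
    case True then show ?thesis using TD(2,6) sub by blast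
  next
    case False
    then have "(u, rootv U) \<in> ?E\<^sup>*" using UD(2,6) sub that by blast
    moreover have "(rootv U, rootv T) \<in> ?E" by simp
    ultimately show ?thesis by (rule rtrancl.rtrancl_into_rtrancl)
  qed
  then have "(u, v) \<in> ?E\<^sup>*" if "u \<in> verts T \<union> verts U" "v \<in> verts T \<union> verts U" for u v
    using that symE by (meson rtrancl_trans symD sym_rtrancl)
  moreover have "irrefl ?E" using TD(2,5) UD(2,5) disj by (auto simp: irrefl_def)
  moreover have "?E \<subseteq> verts (join T U) \<times> verts (join T U)"
    using TD(2,3) UD(2,3) by auto
  ultimately show ?thesis
    using symE TD(1,2) UD(1) no_cycle_join[OF assms]
    unfolding rooted_tree_def by auto
qed

text \<open>For \<open>m\<close> other than the root, this is the connected component of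
  \<open>m\<close> once the root is deleted.\<close>

definition branch :: "'a rooted_graph \<Rightarrow> 'a \<Rightarrow> 'a set" where
  "branch T m = {u. (m, u) \<in> (adj T \<inter> (- {rootv T}) \<times> (- {rootv T}))\<^sup>*}"

text \<open>The only edge leaving \<open>verts U\<close> ends in the deleted root. Hence the cut can
  be read off from the joined tree and \<open>m\<close> alone.\<close>

lemma branch_join:
  assumes T: "rooted_tree T" and U: "rooted_tree U" and disj: "verts T \<inter> verts U = {}"
    and m: "m \<in> verts U"
  shows "branch (join T U) m = verts U"
proof
  note TD = rooted_treeD[OF T] and UD = rooted_treeD[OF U]
  let ?E = "adj (join T U) \<inter> (- {rootv T}) \<times> (- {rootv T})"
  have "adj U \<subseteq> ?E" using TD(2) UD(3) disj by auto
  then have "(adj U)\<^sup>* \<subseteq> ?E\<^sup>*" by (rule rtrancl_mono)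
  then show "verts U \<subseteq> branch (join T U) m"
    using UD(6)[OF m] by (auto simp: branch_def)
  have "u \<in> verts U" if "(m, u) \<in> ?E\<^sup>*" for u
    using that
  proof (induction rule: rtrancl_induct)
    case (step y z)
    then show ?case using TD(2,3) UD(2,3) disj by auto
  qed (use m in simp)
  then show "branch (join T U) m \<subseteq> verts U" by (auto simp: branch_def)
qed

lemma graph_cycle_mono: "graph_cycle E p \<Longrightarrow> E \<subseteq> F \<Longrightarrow> graph_cycle F p"
  by (auto simp: graph_cycle_def)

definition induced :: "'a rooted_graph \<Rightarrow> 'a set \<Rightarrow> 'a \<Rightarrow> 'a rooted_graph" where
  "induced T A r = \<lparr>verts = A, adj = adj T \<inter> A \<times> A, rootv = r\<rparr>"

lemma induced_simps [simp]:
  "verts (induced T A r) = A" "adj (induced T A r) = adj T \<inter> A \<times> A" "rootv (induced T A r) = r"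
  by (simp_all add: induced_def)

lemma rooted_tree_inducedI:
  assumes T: "rooted_tree T" and "A \<subseteq> verts T" "r \<in> A"
    and conn: "\<And>u. u \<in> A \<Longrightarrow> (u, r) \<in> (adj T \<inter> A \<times> A)\<^sup>*"
  shows "rooted_tree (induced T A r)"
proof -
  note TD = rooted_treeD[OF T]
  have s: "sym (adj T \<inter> A \<times> A)" using TD(4) by (auto simp: sym_def)
  have "(u, v) \<in> (adj T \<inter> A \<times> A)\<^sup>*" if "u \<in> A" "v \<in> A" for u v
    using conn[OF that(1)] conn[OF that(2)] s by (meson rtrancl_trans symD sym_rtrancl)
  moreover have "\<not> (\<exists>p. graph_cycle (adj T \<inter> A \<times> A) p)"
    using TD(7) graph_cycle_mono[of "adj T \<inter> A \<times> A" _ "adj T"] by blast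
  moreover have "finite A" using TD(1) assms(2) by (rule rev_finite_subset)
  moreover have "irrefl (adj T \<inter> A \<times> A)" using TD(5) by (auto simp: irrefl_def)
  ultimately show ?thesis using s assms(3) by (auto simp: rooted_tree_def)
qed

text \<open>The component of \<open>m\<close> is attached to the root by exactly one edge: by at
  least one because the tree is connected, by at most one because it has no cycle. The end
  \<open>v\<close> of that edge becomes the root of the branch.\<close>

lemma rooted_tree_split:
  assumes T: "rooted_tree T" and m: "m \<in> verts T" "m \<noteq> rootv T"
  defines "S \<equiv> branch T m"
  obtains v where "v \<in> S" "S \<subseteq> verts T - {rootv T}" "m \<in> S"
    "rooted_tree (induced T (verts T - S) (rootv T))" "rooted_tree (induced T S v)"
    "join (induced T (verts T - S) (rootv T)) (induced T S v) = T"
proof -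
  note TD = rooted_treeD[OF T]
  let ?r = "rootv T"
  let ?E = "adj T \<inter> (- {?r}) \<times> (- {?r})"
  have symE: "sym ?E" using TD(4) by (auto simp: sym_def)
  have mS: "m \<in> S" by (simp add: S_def branch_def)
  have S_sub: "S \<subseteq> verts T - {?r}"
  proof
    fix u assume "u \<in> S"
    then have "(m, u) \<in> ?E\<^sup>*" by (simp add: S_def branch_def)
    then show "u \<in> verts T - {?r}"
      by (induction rule: rtrancl_induct) (use m TD(3) in auto)
  qed
  have closed: "w \<in> S" if "u \<in> S" "(u, w) \<in> adj T" "w \<noteq> ?r" for u w
  proof -
    have "(u, w) \<in> ?E" using that S_sub by auto
    then show ?thesis using that(1) unfolding S_def branch_def
      by (auto intro: rtrancl.rtrancl_into_rtrancl)
  qed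
  have conn: "(u, w) \<in> (adj T \<inter> S \<times> S)\<^sup>*" if "u \<in> S" "w \<in> S" for u w
  proof -
    have "(m, u) \<in> ?E\<^sup>*" "(m, w) \<in> ?E\<^sup>*" using that by (auto simp: S_def branch_def)
    then have "(u, w) \<in> ?E\<^sup>*" using symE by (meson rtrancl_trans symD sym_rtrancl)
    then have "w \<in> S \<and> (u, w) \<in> (adj T \<inter> S \<times> S)\<^sup>*"
    proof (induction rule: rtrancl_induct)
      case base then show ?case using that by simp
    next
      case (step y z)
      then have "z \<in> S" using closed[of y z] by auto
      then have "(y, z) \<in> adj T \<inter> S \<times> S" using step by auto
      then show ?case using step \<open>z \<in> S\<close> by (meson rtrancl.rtrancl_into_rtrancl)
    qed
    then show ?thesis ..
  qed
  \<comment> \<open>A path to the root can enter \<open>S\<close> only from the root itself, where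
    it may already stop.\<close>
  have conn': "(u, ?r) \<in> (adj T \<inter> (verts T - S) \<times> (verts T - S))\<^sup>*" if "u \<in> verts T - S" for u
  proof -
    have "(u, ?r) \<in> (adj T)\<^sup>*" using TD(2,6) that by blast
    then show ?thesis using that
    proof (induction rule: converse_rtrancl_induct)
      case (step y z)
      show ?case
      proof (cases "y = ?r")
        case False
        have "z \<notin> S" using closed[of z y] step.hyps(1) step.prems False TD(4) by (auto dest: symD)
        then have "z \<in> verts T - S" using step TD(3) by auto
        then show ?thesis using step by (meson IntI SigmaI converse_rtrancl_into_rtrancl)
      qed simp
    qed simp
  qed
  \<comment> \<open>Without such an edge \<open>S\<close> would be closed under adjacency, and a
    path from \<open>m\<close> to the root could not leave it.\<close>
  have "\<exists>v\<in>S. (?r, v) \<in> adj T"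
  proof (rule ccontr)
    assume *: "\<not> ?thesis"
    have "(m, ?r) \<in> (adj T)\<^sup>*" using TD(2,6) m by blast
    then have "?r \<in> S"
    proof (induction rule: rtrancl_induct)
      case (step y z)
      then show ?case using * closed[of y z] TD(4) by (auto dest: symD)
    qed (rule mS)
    then show False using S_sub by auto
  qed
  then obtain v where v: "v \<in> S" "(?r, v) \<in> adj T" by blast
  have uniq: "w = v" if "w \<in> S" "(?r, w) \<in> adj T" for w
  proof (rule acyclic_neighbour_unique[OF TD(7,4) that(2) v(2)])
    have "adj T \<inter> S \<times> S \<subseteq> ?E" using S_sub by auto
    from rtrancl_mono[OF this] show "(w, v) \<in> ?E\<^sup>*" using conn[OF that(1) v(1)] by blast
    show "w \<noteq> ?r" using that S_sub by auto
  qed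
  have cross: "x = ?r \<and> y = v" if "(x, y) \<in> adj T" "x \<notin> S" "y \<in> S" for x y
  proof -
    have "(y, x) \<in> adj T" using that TD(4) by (auto dest: symD)
    then have "x = ?r" using closed[of y x] that by auto
    then show ?thesis using uniq that by auto
  qed
  have "adj T = adj T \<inter> (verts T - S) \<times> (verts T - S) \<union> adj T \<inter> S \<times> S \<union> {(?r, v), (v, ?r)}"
    (is "_ = ?R")
  proof
    show "?R \<subseteq> adj T" using v TD(4) by (auto dest: symD)
    show "adj T \<subseteq> ?R"
    proof (rule subrelI)
      fix x y assume xy: "(x, y) \<in> adj T"
      then have "(y, x) \<in> adj T" using TD(4) by (auto dest: symD)
      then show "(x, y) \<in> ?R" using cross[of x y] cross[of y x] xy TD(3) by blast
    qed
  qed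
  then have "join (induced T (verts T - S) ?r) (induced T S v) = T"
    using S_sub by (intro rooted_graph.equality) auto
  moreover have "rooted_tree (induced T (verts T - S) ?r)"
    using S_sub TD(2) conn' by (intro rooted_tree_inducedI[OF T]) auto
  moreover have "rooted_tree (induced T S v)"
    using S_sub v conn by (intro rooted_tree_inducedI[OF T]) auto
  ultimately show thesis using that v(1) S_sub mS by blast
qed

text \<open>The mark \<open>m\<close> tells which branch was hung on: \<open>branch_join\<close>
  recovers its vertex set, both parts are then induced subgraphs, and the root of the branch is the
  only neighbour of the main root inside it.\<close>

lemma join_inject:
  assumes "rooted_tree T" "rooted_tree U" "verts T \<inter> verts U = {}" "m \<in> verts U"
    and "rooted_tree T'" "rooted_tree U'" "verts T' \<inter> verts U' = {}" "m \<in> verts U'"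
    and eq: "join T U = join T' U'"
  shows "T = T' \<and> U = U'"
proof -
  note D = rooted_treeD[OF assms(1)] rooted_treeD[OF assms(2)]
    rooted_treeD[OF assms(5)] rooted_treeD[OF assms(6)]
  have vU: "verts U = verts U'"
    using branch_join[OF assms(1-4)] branch_join[OF assms(5-8)] eq by simp
  have "verts T \<union> verts U = verts T' \<union> verts U'" and r: "rootv T = rootv T'"
    and E: "adj (join T U) = adj (join T' U')"
    using arg_cong[OF eq, of verts] arg_cong[OF eq, of rootv] arg_cong[OF eq, of adj]
    unfolding join_simps .
  then have vT: "verts T = verts T'" using vU assms(3,7) by blast
  have "adj T = adj (join T U) \<inter> verts T \<times> verts T" if "rooted_tree T" "rooted_tree U"
    "verts T \<inter> verts U = {}" for T U :: "'a rooted_graph"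
    using rooted_treeD(2,3)[OF that(1)] rooted_treeD(2,3)[OF that(2)] that(3) by auto
  then have aT: "adj T = adj T'" using assms E vT by metis
  have "adj U = adj (join T U) \<inter> verts U \<times> verts U" if "rooted_tree T" "rooted_tree U"
    "verts T \<inter> verts U = {}" for T U :: "'a rooted_graph"
    using rooted_treeD(2,3)[OF that(1)] rooted_treeD(2,3)[OF that(2)] that(3) by auto
  then have aU: "adj U = adj U'" using assms E vU by metis
  have "(rootv T, rootv U) \<in> adj (join T' U')" using E[symmetric] by simp
  then have "rootv U = rootv U'"
    using D r vU vT assms(3,7) by auto
  then show ?thesis using vU vT aT aU r by (auto intro: rooted_graph.equality)
qed

section \<open>Counting labelled trees\<close>

lemma bij_betw_card_Collect:
  assumes "bij_betw f A B" "\<And>x. x \<in> A \<Longrightarrow> P x \<longleftrightarrow> Q (f x)"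
  shows "card {x \<in> A. P x} = card {y \<in> B. Q y}"
proof -
  have "bij_betw f {x \<in> A. P x} {y \<in> B. Q y}"
    using assms unfolding bij_betw_def by (auto simp: inj_on_def)
  then show ?thesis by (rule bij_betw_same_card)
qed

text \<open>Colorings are pulled back along \<open>f\<close>. The function \<Phi> is kept general so
  that this gives the isomorphism invariance of all four weights at once.\<close>

lemma sum_colorings_iso:
  fixes \<Phi> :: "nat \<Rightarrow> nat \<Rightarrow> nat \<Rightarrow> 'c::comm_monoid_add"
  assumes iso: "rooted_iso f S T" and root: "rootv S \<in> verts S"
  shows "(\<Sum>c\<in>colorings S. \<Phi> (c (rootv S)) (card (black_nbrs S c (rootv S))) (card (even_white S c)))
       = (\<Sum>c\<in>colorings T. \<Phi> (c (rootv T)) (card (black_nbrs T c (rootv T))) (card (even_white T c)))"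
    (is "sum ?F _ = sum ?G _")
proof -
  let ?i = "\<lambda>c. \<lambda>y\<in>verts T. c (inv_into (verts S) f y)"
  let ?j = "\<lambda>c. \<lambda>x\<in>verts S. c (f x)"
  have bij: "bij_betw f (verts S) (verts T)" and rt: "f (rootv S) = rootv T"
    and adj: "\<And>u v. u \<in> verts S \<Longrightarrow> v \<in> verts S \<Longrightarrow> (u, v) \<in> adj S \<longleftrightarrow> (f u, f v) \<in> adj T"
    using iso by (auto simp: rooted_iso_def)
  have f: "f x \<in> verts T" if "x \<in> verts S" for x using bij that by (rule bij_betwE[THEN bspec])
  have g: "inv_into (verts S) f y \<in> verts S" "f (inv_into (verts S) f y) = y" if "y \<in> verts T" for y
    using bij_betwE[OF bij_betw_inv_into[OF bij]] bij_betw_inv_into_right[OF bij] that by auto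
  have gf: "inv_into (verts S) f (f x) = x" if "x \<in> verts S" for x
    using bij_betw_inv_into_left[OF bij that] .
  have nb: "card (black_nbrs S (?j c) u) = card (black_nbrs T c (f u))" if "u \<in> verts S" for u c
    unfolding black_nbrs_def using that adj by (intro bij_betw_card_Collect[OF bij]) auto
  have "card (even_white S (?j c)) = card (even_white T c)" for c
    unfolding even_white_def using nb by (intro bij_betw_card_Collect[OF bij]) auto
  then have "?F (?j c) = ?G c" for c
    using nb[OF root] root rt by simp
  moreover have "?j (?i c) = c" if "c \<in> colorings S" for c
    using PiE_arb[OF that[unfolded colorings_def]] f gf by (auto simp: fun_eq_iff)
  moreover have "?i (?j c) = c" if "c \<in> colorings T" for c
    using PiE_arb[OF that[unfolded colorings_def]] g by (auto simp: fun_eq_iff)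
  moreover have "?j c \<in> colorings S" if "c \<in> colorings T" for c
    using that f unfolding colorings_def by (intro restrict_PiE_iff[THEN iffD2]) auto
  moreover have "?i c \<in> colorings T" if "c \<in> colorings S" for c
    using that g(1) unfolding colorings_def by (intro restrict_PiE_iff[THEN iffD2]) auto
  ultimately show ?thesis
    by (intro sum.reindex_bij_witness[of _ ?j ?i]) metis+
qed

section \<open>Relabelling and orbit counting\<close>

lemma rooted_iso_comp:
  assumes "rooted_iso f S T" "rooted_iso g T U"
  shows "rooted_iso (g \<circ> f) S U"
proof -
  have "bij_betw f (verts S) (verts T)" using assms by (simp add: rooted_iso_def)
  from bij_betwE[OF this] show ?thesis
    using assms by (auto simp: rooted_iso_def intro: bij_betw_trans)
qed

lemma rooted_iso_inv:
  assumes "f permutes V" "rooted_iso f S T" "verts S = V" "verts T = V" "rootv S \<in> V"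
  shows "rooted_iso (inv f) T S"
proof -
  let ?g = "inv f"
  have g: "?g permutes V" using assms(1) by (rule permutes_inv)
  have fg: "f (?g x) = x" "?g (f x) = x" for x
    using permutes_inverses[OF assms(1)] by auto
  have gV: "?g x \<in> V" if "x \<in> V" for x using permutes_in_image[OF g] that by simp
  have "(u, v) \<in> adj T \<longleftrightarrow> (?g u, ?g v) \<in> adj S" if "u \<in> V" "v \<in> V" for u v
    using assms(2,3) gV[OF that(1)] gV[OF that(2)] fg(1) by (simp add: rooted_iso_def)
  moreover have "?g (rootv T) = rootv S"
    using assms(2) fg(2)[of "rootv S"] by (simp add: rooted_iso_def)
  ultimately show ?thesis
    using assms(3,4) permutes_imp_bij[OF g] by (simp add: rooted_iso_def)
qed

definition relabel :: "('a \<Rightarrow> 'b) \<Rightarrow> 'a rooted_graph \<Rightarrow> 'b rooted_graph" where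
  "relabel f T = \<lparr>verts = f ` verts T, adj = map_prod f f ` adj T, rootv = f (rootv T)\<rparr>"

lemma rooted_iso_relabel:
  assumes "inj_on f (verts T)" "adj T \<subseteq> verts T \<times> verts T"
  shows "rooted_iso f T (relabel f T)"
proof -
  have "(u, v) \<in> adj T" if uv: "u \<in> verts T" "v \<in> verts T" "(f u, f v) \<in> map_prod f f ` adj T" for u v
  proof -
    obtain x y where "(x, y) \<in> adj T" "f u = f x" "f v = f y" using uv(3) by auto
    then show ?thesis using uv assms by (metis inj_onD mem_Sigma_iff subset_iff)
  qed
  then have "(u, v) \<in> adj T \<longleftrightarrow> (f u, f v) \<in> map_prod f f ` adj T"
    if "u \<in> verts T" "v \<in> verts T" for u v
    using that by (metis image_eqI map_prod_simp)
  then show ?thesis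
    using assms(1) by (simp add: rooted_iso_def relabel_def inj_on_imp_bij_betw)
qed

lemma rooted_tree_relabel:
  assumes T: "rooted_tree T" and inj: "inj_on f (verts T)"
  shows "rooted_tree (relabel f T)"
proof -
  note TD = rooted_treeD[OF T]
  let ?E = "map_prod f f ` adj T" and ?g = "inv_into (verts T) f"
  have gf: "?g (f x) = x" if "x \<in> verts T" for x using inj that by (rule inv_into_f_f)
  have E: "(?g y, ?g z) \<in> adj T" if "(y, z) \<in> ?E" for y z
    using that TD(3) gf by auto
  have "sym ?E" using TD(4) unfolding sym_def by (fastforce simp: image_iff)
  moreover have "irrefl ?E" using E TD(5) by (meson irreflD irreflI)
  moreover have "(f u, f v) \<in> ?E\<^sup>*" if "(u, v) \<in> (adj T)\<^sup>*" for u v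
    using that
  proof (induction rule: rtrancl_induct)
    case (step y z)
    then have "(f y, f z) \<in> ?E" by force
    then show ?case using step by (meson rtrancl.rtrancl_into_rtrancl)
  qed simp
  moreover have "\<not> graph_cycle ?E p" for p
  proof
    assume p: "graph_cycle ?E p"
    then have s: "Suc i mod length p < length p" for i
      by (intro mod_less_divisor) (auto simp: graph_cycle_def)
    have mem: "x \<in> f ` verts T" if "x \<in> set p" for x
      using that p TD(3) by (fastforce simp: graph_cycle_def in_set_conv_nth)
    have "inj_on ?g (set p)"
      using mem by (intro inj_on_subset[OF inj_on_inv_into[OF subset_refl]]) auto
    then have "graph_cycle (adj T) (map ?g p)"
      using p s E unfolding graph_cycle_def by (auto simp: distinct_map)
    then show False using TD(7) by blast
  qed
  ultimately show ?thesis
    using TD(1-3,6) by (auto simp: rooted_tree_def relabel_def)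
qed

text \<open>Orbit counting: the \<open>n!\<close> permutations of the labels are distributed evenly over the
  isomorphism class of \<open>T\<close>, each member being reached \<open>|Aut T|\<close> times.\<close>

lemma card_class_mult_card_auts:
  assumes X: "X \<in> rooted_tree_classes n" and T: "T \<in> X"
  shows "card X * card (rooted_auts T) = fact n"
proof -
  let ?V = "{..<n}"
  have X_eq: "X = rooted_iso_rel n `` {T}"
    using X T equiv_rooted_iso_rel
    by (metis quotientE equiv_class_eq Image_singleton_iff rooted_tree_classes_def)
  have Tn: "T \<in> rooted_trees n"
    using X T equiv_rooted_iso_rel[of n] in_quotient_imp_subset
    unfolding rooted_tree_classes_def by blast
  then have rT: "rooted_tree T" and vT: "verts T = ?V" by (auto simp: rooted_trees_def)
  note TD = rooted_treeD[OF rT]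
  let ?P = "\<lambda>U. {\<pi>. \<pi> permutes ?V \<and> rooted_iso \<pi> T U}"
  \<comment> \<open>The permutation \<pi> determines its target, since root and edges are images of
    those of \<open>T\<close>. Hence the sets \<open>?P U\<close> are disjoint.\<close>
  have uniq: "U = U'" if "U \<in> X" "U' \<in> X" "\<pi> \<in> ?P U" "\<pi> \<in> ?P U'" for U U' \<pi>
  proof (rule rooted_graph.equality)
    have U: "rooted_tree U" "rooted_tree U'" "verts U = ?V" "verts U' = ?V"
      using that by (auto simp: X_eq rooted_iso_rel_def rooted_trees_def)
    then show "verts U = verts U'" by simp
    show "rootv U = rootv U'" using that by (auto simp: rooted_iso_def)
    have "(u, v) \<in> adj U \<longleftrightarrow> (u, v) \<in> adj U'" for u v
    proof (cases "u \<in> ?V \<and> v \<in> ?V")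
      case True
      have p: "\<pi> permutes ?V" using that by simp
      have "\<pi> (inv \<pi> u) = u" "\<pi> (inv \<pi> v) = v" "inv \<pi> u \<in> ?V" "inv \<pi> v \<in> ?V"
        using p True permutes_inverses(1)[OF p] permutes_in_image[OF permutes_inv[OF p]] by auto
      moreover have "\<forall>x\<in>?V. \<forall>y\<in>?V. (x, y) \<in> adj T \<longleftrightarrow> (\<pi> x, \<pi> y) \<in> adj U"
        "\<forall>x\<in>?V. \<forall>y\<in>?V. (x, y) \<in> adj T \<longleftrightarrow> (\<pi> x, \<pi> y) \<in> adj U'"
        using that(3,4) vT by (simp_all add: rooted_iso_def)
      ultimately show ?thesis by metis
    next
      case False
      then show ?thesis using rooted_treeD(3)[OF U(1)] rooted_treeD(3)[OF U(2)] U(3,4) by auto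
    qed
    then show "adj U = adj U'" by auto
  qed simp
  have ex: "\<exists>U\<in>X. \<pi> \<in> ?P U" if p: "\<pi> permutes ?V" for \<pi>
  proof
    have inj: "inj_on \<pi> (verts T)" using permutes_inj_on[OF p] .
    show "\<pi> \<in> ?P (relabel \<pi> T)"
      using rooted_iso_relabel[OF inj TD(3)] p by simp
    moreover have "verts (relabel \<pi> T) = ?V"
      using permutes_image[OF p] vT by (simp add: relabel_def)
    ultimately show "relabel \<pi> T \<in> X"
      using Tn rooted_tree_relabel[OF rT inj] by (auto simp: X_eq rooted_iso_rel_def rooted_trees_def)
  qed
  \<comment> \<open>With one isomorphism \<pi> onto \<open>U\<close> fixed, all others are \<pi>
    composed with an automorphism of \<open>T\<close>.\<close>
  have fib: "card (?P U) = card (rooted_auts T)" if U: "U \<in> X" for U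
  proof -
    have vU: "verts U = ?V" and "\<exists>f. rooted_iso f T U"
      using U by (auto simp: X_eq rooted_iso_rel_def rooted_trees_def)
    then obtain f where f: "rooted_iso f T U" by blast
    \<comment> \<open>An isomorphism is arbitrary outside the vertices; extending it by the identity
      makes it a permutation in the sense of \<open>permutes\<close>.\<close>
    define \<pi> where "\<pi> x = (if x \<in> ?V then f x else x)" for x
    have "bij_betw \<pi> ?V ?V"
      using f vT vU bij_betw_cong[of ?V \<pi> f] by (simp add: \<pi>_def rooted_iso_def)
    then have p: "\<pi> permutes ?V"
      by (rule bij_imp_permutes) (simp add: \<pi>_def)
    have iso: "rooted_iso \<pi> T U"
      using f \<open>bij_betw \<pi> ?V ?V\<close> vT vU TD(2) by (auto simp: rooted_iso_def \<pi>_def)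
    have iso': "rooted_iso (inv \<pi>) U T"
      using rooted_iso_inv[OF p iso] vT vU TD(2) by simp
    have "bij_betw (\<lambda>\<alpha>. \<pi> \<circ> \<alpha>) (rooted_auts T) (?P U)"
    proof (rule bij_betw_byWitness[where f' = "\<lambda>\<rho>. inv \<pi> \<circ> \<rho>"])
      show "(\<lambda>\<alpha>. \<pi> \<circ> \<alpha>) ` rooted_auts T \<subseteq> ?P U"
        using p iso vT by (auto simp: rooted_auts_def intro: permutes_compose rooted_iso_comp)
      show "(\<lambda>\<rho>. inv \<pi> \<circ> \<rho>) ` ?P U \<subseteq> rooted_auts T"
        using permutes_inv[OF p] iso' vT
        by (auto simp: rooted_auts_def intro: permutes_compose rooted_iso_comp)
    qed (use permutes_inv_o[OF p] in \<open>auto simp: o_assoc\<close>)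
    then show ?thesis by (rule bij_betw_same_card[symmetric])
  qed
  have finX: "finite X"
    by (rule finite_subset[OF _ finite_rooted_trees[of n]]) (auto simp: X_eq rooted_iso_rel_def)
  have finP: "finite (?P U)" for U
    by (rule finite_subset[OF _ finite_permutations[of ?V]]) auto
  have "fact n = card {\<pi>. \<pi> permutes ?V}" using card_permutations[of ?V n] by simp
  also have "{\<pi>. \<pi> permutes ?V} = (\<Union>U\<in>X. ?P U)" using ex by blast
  also have "card \<dots> = (\<Sum>U\<in>X. card (?P U))"
    using finX finP uniq by (intro card_UN_disjoint) blast+
  also have "\<dots> = card X * card (rooted_auts T)" using fib by simp
  finally show ?thesis by simp
qed

text \<open>By orbit counting, n! / |Aut T| is the size of the class of \<open>T\<close>, so the
  weighted sum over classes becomes a plain sum over labelled trees.\<close>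

lemma tree_sum_nth:
  assumes inv: "\<And>S T h. S \<in> rooted_trees n \<Longrightarrow> T \<in> rooted_trees n \<Longrightarrow> rooted_iso h S T \<Longrightarrow> f S = f T"
  shows "of_nat (fact n) * fps_nth (tree_sum f) n = (\<Sum>T\<in>rooted_trees n. f T)"
proof -
  have eq: "equiv (rooted_trees n) (rooted_iso_rel n)" by (rule equiv_rooted_iso_rel)
  have class_sum: "of_nat (fact n) * smult (1 / of_nat (card (rooted_auts T))) (f T) = (\<Sum>U\<in>X. f U)"
    if X: "X \<in> rooted_tree_classes n" and T: "T \<in> X" for X T
  proof -
    have "f U = f T" if "U \<in> X" for U
    proof -
      have "(T, U) \<in> rooted_iso_rel n"
        using X T that eq unfolding rooted_tree_classes_def by (metis quotient_eq_iff)
      then show ?thesis using inv by (auto simp: rooted_iso_rel_def)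
    qed
    then have "(\<Sum>U\<in>X. f U) = of_nat (card X) * f T" by simp
    moreover have c: "card X * card (rooted_auts T) = fact n"
      using card_class_mult_card_auts[OF X T] .
    then have "card (rooted_auts T) \<noteq> 0" by (metis fact_nonzero mult_0_right)
    then have "of_nat (fact n) * (1 / of_nat (card (rooted_auts T))) = (of_nat (card X) :: rat)"
      using c[symmetric] by simp
    ultimately show ?thesis
      by (simp add: of_nat_poly)
  qed
  have "of_nat (fact n) * fps_nth (tree_sum f) n = (\<Sum>X\<in>rooted_tree_classes n. \<Sum>U\<in>X. f U)"
    unfolding tree_sum_def fps_nth_Abs_fps sum_distrib_left Let_def
  proof (intro sum.cong refl class_sum)
    fix X assume "X \<in> rooted_tree_classes n"
    then have "X \<noteq> {}" using eq unfolding rooted_tree_classes_def by (metis in_quotient_imp_non_empty)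
    then show "(SOME T. T \<in> X) \<in> X" by (simp add: some_in_eq)
  qed
  also have "\<dots> = sum f (\<Union>(rooted_tree_classes n))"
  proof (rule sum.Union_disjoint[symmetric, unfolded comp_def])
    show "\<forall>A\<in>rooted_tree_classes n. finite A"
      using finite_rooted_trees in_quotient_imp_subset[OF eq]
      unfolding rooted_tree_classes_def by (metis finite_subset)
    show "\<forall>A\<in>rooted_tree_classes n. \<forall>B\<in>rooted_tree_classes n. A \<noteq> B \<longrightarrow> A \<inter> B = {}"
      using quotient_disj[OF eq] unfolding rooted_tree_classes_def by blast
  qed
  also have "\<Union>(rooted_tree_classes n) = rooted_trees n"
    unfolding rooted_tree_classes_def by (rule Union_quotient[OF eq])
  finally show ?thesis .
qed

section \<open>Colored trees\<close>

text \<open>Label set and root are both parameters, so that the two parts of a split tree are again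
  of this kind.\<close>

definition colored_trees :: "'a set \<Rightarrow> 'a \<Rightarrow> ('a rooted_graph \<times> ('a \<Rightarrow> nat)) set" where
  "colored_trees A r =
     {(T, c). rooted_tree T \<and> verts T = A \<and> rootv T = r \<and> c \<in> colorings T}"

lemma colored_treesD:
  assumes "(T, c) \<in> colored_trees A r"
  shows "rooted_tree T" "verts T = A" "rootv T = r" "c \<in> A \<rightarrow>\<^sub>E {0, 1}" "r \<in> A" "c r \<in> {0, 1}"
proof -
  show *: "rooted_tree T" "verts T = A" "rootv T = r" "c \<in> A \<rightarrow>\<^sub>E {0, 1}"
    using assms by (auto simp: colored_trees_def colorings_def)
  then show "r \<in> A" using rooted_treeD(2)[of T] by simp
  then show "c r \<in> {0, 1}" using *(4) by blast
qed

lemma finite_colored_trees: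
  assumes "finite A"
  shows "finite (colored_trees A r)"
proof (rule finite_subset)
  show "colored_trees A r \<subseteq>
      (\<lambda>E. \<lparr>verts = A, adj = E, rootv = r\<rparr>) ` Pow (A \<times> A) \<times> (A \<rightarrow>\<^sub>E {0, 1})"
  proof (rule subrelI)
    fix T c assume *: "(T, c) \<in> colored_trees A r"
    then have "T = \<lparr>verts = A, adj = adj T, rootv = r\<rparr>" "adj T \<in> Pow (A \<times> A)"
      using colored_treesD[OF *] rooted_treeD(3)[of T] by auto
    then show "(T, c) \<in>
        (\<lambda>E. \<lparr>verts = A, adj = E, rootv = r\<rparr>) ` Pow (A \<times> A) \<times> (A \<rightarrow>\<^sub>E {0, 1})"
      using colored_treesD(4)[OF *] by blast
  qed
qed (intro finite_cartesian_product finite_imageI finite_PiE; simp add: assms)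

text \<open>Falling back to \<open>c\<close> off \<open>verts U\<close> keeps the result
  extensional: where neither part has a vertex, an extensional \<open>c\<close> is already
  undefined.\<close>

fun colored_join ::
  "'a rooted_graph \<times> ('a \<Rightarrow> nat) \<Rightarrow> 'a rooted_graph \<times> ('a \<Rightarrow> nat) \<Rightarrow> 'a rooted_graph \<times> ('a \<Rightarrow> nat)"
  where "colored_join (T, c) (U, d) = (join T U, \<lambda>x. if x \<in> verts U then d x else c x)"

lemma colored_join_in:
  assumes "x \<in> colored_trees A r" "y \<in> colored_trees S v" "A \<inter> S = {}"
  shows "colored_join x y \<in> colored_trees (A \<union> S) r"
proof -
  obtain T c U d where [simp]: "x = (T, c)" "y = (U, d)" by fastforce
  note x = colored_treesD[OF assms(1)[simplified]] and y = colored_treesD[OF assms(2)[simplified]]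
  have "rooted_tree (join T U)" using rooted_tree_join x y assms(3) by blast
  moreover have "(\<lambda>x. if x \<in> S then d x else c x) \<in> A \<union> S \<rightarrow>\<^sub>E {0, 1}"
    using x(4) y(4) by (auto simp: PiE_iff extensional_def)
  ultimately show ?thesis using x y by (auto simp: colored_trees_def colorings_def)
qed

lemma colored_join_inject:
  assumes x: "x \<in> colored_trees A r" and y: "y \<in> colored_trees S v" and AS: "A \<inter> S = {}" "m \<in> S"
    and x': "x' \<in> colored_trees A' r'" and y': "y' \<in> colored_trees S' v'"
    and AS': "A' \<inter> S' = {}" "m \<in> S'"
    and eq: "colored_join x y = colored_join x' y'"
  shows "x = x' \<and> y = y'"
proof -
  obtain T c U d where [simp]: "x = (T, c)" "y = (U, d)" by fastforce
  obtain T' c' U' d' where [simp]: "x' = (T', c')" "y' = (U', d')" by fastforce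
  note D = colored_treesD[OF x[simplified]] colored_treesD[OF y[simplified]]
  note D' = colored_treesD[OF x'[simplified]] colored_treesD[OF y'[simplified]]
  have TU: "T = T' \<and> U = U'"
    using join_inject[of T U m T' U'] D D' AS AS' eq by simp
  then have [simp]: "A' = A" "S' = S" using D(2,8) D'(2,8) by auto
  have *: "(if z \<in> S then d z else c z) = (if z \<in> S then d' z else c' z)" for z
  proof -
    have "(\<lambda>x. if x \<in> S then d x else c x) = (\<lambda>x. if x \<in> S then d' x else c' x)"
      using eq D(8) D'(8) by simp
    then show ?thesis by (rule fun_cong)
  qed
  have "c z = c' z" for z
    using *[of z] PiE_arb[OF D(4), of z] PiE_arb[OF D'(4), of z] AS(1)
    by (cases "z \<in> A") (auto simp: disjoint_iff)
  moreover have "d z = d' z" for z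
    using *[of z] PiE_arb[OF D(10), of z] PiE_arb[OF D'(10), of z] by (cases "z \<in> S") auto
  ultimately show ?thesis using TU by auto
qed

lemma colored_join_surj:
  assumes z: "z \<in> colored_trees A r" and m: "m \<in> A" "m \<noteq> r"
  obtains S v x y where "S \<subseteq> A - {r}" "m \<in> S" "v \<in> S" "x \<in> colored_trees (A - S) r"
    "y \<in> colored_trees S v" "z = colored_join x y"
proof -
  obtain T c where [simp]: "z = (T, c)" by fastforce
  note D = colored_treesD[OF z[simplified]]
  obtain S v where S: "v \<in> S" "S \<subseteq> A - {r}" "m \<in> S"
    "rooted_tree (induced T (A - S) r)" "rooted_tree (induced T S v)"
    "join (induced T (A - S) r) (induced T S v) = T"
    using rooted_tree_split[of T m] D m by metis
  have c: "c x \<in> {0, 1}" if "x \<in> A \<or> x \<in> S" for x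
    using that S(2) PiE_mem[OF D(4)] by blast
  show thesis
  proof (rule that[of S v "(induced T (A - S) r, restrict c (A - S))" "(induced T S v, restrict c S)"])
    have "(\<lambda>x. if x \<in> S then restrict c S x else restrict c (A - S) x) = c"
      using PiE_arb[OF D(4)] by (auto simp: fun_eq_iff)
    then show "z = colored_join (induced T (A - S) r, restrict c (A - S))
        (induced T S v, restrict c S)"
      using S by simp
  qed (use S c in \<open>auto simp: colored_trees_def colorings_def\<close>)
qed

text \<open>Existence and uniqueness of the cut at \<open>m\<close> make \<open>colored_join\<close>
  a bijection from the possible pairs of parts, with \<open>S\<close> the branch and
  \<open>v\<close> its root.\<close>

lemma sum_colored_trees_split:
  fixes F :: "'a rooted_graph \<times> ('a \<Rightarrow> nat) \<Rightarrow> 'b::comm_monoid_add"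
  assumes "finite A" "r \<in> A" "m \<in> A" "m \<noteq> r"
  shows "(\<Sum>z\<in>colored_trees A r. F z) =
    (\<Sum>S\<in>{S. S \<subseteq> A - {r} \<and> m \<in> S}. \<Sum>v\<in>S. \<Sum>x\<in>colored_trees (A - S) r.
       \<Sum>y\<in>colored_trees S v. F (colored_join x y))"
proof -
  let ?P = "{S. S \<subseteq> A - {r} \<and> m \<in> S}"
  let ?D = "SIGMA S:?P. SIGMA v:S. colored_trees (A - S) r \<times> colored_trees S v"
  let ?J = "\<lambda>(S, v, x, y). colored_join x y"
  have bij: "bij_betw ?J ?D (colored_trees A r)"
    unfolding bij_betw_def
  proof
    show "inj_on ?J ?D"
    proof (rule inj_onI)
      fix p q assume p: "p \<in> ?D" and q: "q \<in> ?D" and eq: "?J p = ?J q"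
      obtain S v x y S' v' x' y' where [simp]: "p = (S, v, x, y)" "q = (S', v', x', y')"
        by (metis prod_cases4)
      have h: "x \<in> colored_trees (A - S) r" "y \<in> colored_trees S v" "m \<in> S"
        "x' \<in> colored_trees (A - S') r" "y' \<in> colored_trees S' v'" "m \<in> S'"
        using p q by auto
      have "x = x' \<and> y = y'"
        using h eq by (intro colored_join_inject[of x "A - S" r y S v m x' "A - S'" r y' S' v']) auto
      moreover from this have "S = S' \<and> v = v'"
        using h(2,5) by (cases y) (auto simp: colored_trees_def)
      ultimately show "p = q" by simp
    qed
    show "?J ` ?D = colored_trees A r"
    proof
      show "?J ` ?D \<subseteq> colored_trees A r"
      proof (rule image_subsetI)
        fix p assume p: "p \<in> ?D"
        obtain S v x y where [simp]: "p = (S, v, x, y)" by (metis prod_cases4)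
        have S: "S \<subseteq> A - {r}" and xy: "x \<in> colored_trees (A - S) r" "y \<in> colored_trees S v"
          using p by auto
        have "colored_join x y \<in> colored_trees (A - S \<union> S) r"
          using xy by (intro colored_join_in) auto
        moreover have "A - S \<union> S = A" using S by auto
        ultimately show "?J p \<in> colored_trees A r" by simp
      qed
      show "colored_trees A r \<subseteq> ?J ` ?D"
      proof
        fix z assume "z \<in> colored_trees A r"
        then obtain S v x y where *: "S \<subseteq> A - {r}" "m \<in> S" "v \<in> S"
          "x \<in> colored_trees (A - S) r" "y \<in> colored_trees S v" "z = colored_join x y"
          using colored_join_surj assms by metis
        then have "(S, v, x, y) \<in> ?D" by simp
        then show "z \<in> ?J ` ?D" using *(6) by (intro image_eqI[where x = "(S, v, x, y)"]) auto
      qed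
    qed
  qed
  have fin: "finite ?P" "\<And>S. S \<in> ?P \<Longrightarrow> finite S"
    "\<And>S v. S \<in> ?P \<Longrightarrow> finite (colored_trees (A - S) r \<times> colored_trees S v)"
    using assms(1) by (auto intro!: finite_cartesian_product finite_colored_trees
        intro: finite_subset[of _ A])
  have "(\<Sum>z\<in>colored_trees A r. F z) = (\<Sum>p\<in>?D. F (?J p))"
    using sum.reindex_bij_betw[OF bij, of F] by simp
  also have "\<dots> = (\<Sum>S\<in>?P. \<Sum>p\<in>(SIGMA v:S. colored_trees (A - S) r \<times> colored_trees S v).
      F (?J (S, p)))"
    using fin by (subst sum.Sigma) (auto simp: case_prod_beta intro!: finite_SigmaI)
  also have "\<dots> = (\<Sum>S\<in>?P. \<Sum>v\<in>S. \<Sum>q\<in>colored_trees (A - S) r \<times> colored_trees S v.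
      F (?J (S, v, q)))"
    using fin by (intro sum.cong refl, subst sum.Sigma) (auto simp: case_prod_beta)
  also have "\<dots> = (\<Sum>S\<in>?P. \<Sum>v\<in>S. \<Sum>x\<in>colored_trees (A - S) r.
      \<Sum>y\<in>colored_trees S v. F (colored_join x y))"
    by (intro sum.cong refl) (simp add: sum.cartesian_product case_prod_beta)
  finally show ?thesis .
qed

text \<open>The root is left out of the count of even-white vertices; the number of its black neighbours
  is recorded by a sign variable \<open>\<sigma>\<close>, so that even and odd are recovered from \<open>\<sigma> = 1\<close> and
  \<open>\<sigma> = -1\<close> and the weight becomes multiplicative.\<close>

fun root_weight :: "'b::field \<Rightarrow> nat \<Rightarrow> 'b \<Rightarrow> 'a rooted_graph \<times> ('a \<Rightarrow> nat) \<Rightarrow> 'b" where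
  "root_weight t \<epsilon> \<sigma> (T, c) =
     (if c (rootv T) = \<epsilon> then \<sigma> ^ card (black_nbrs T c (rootv T)) *
        t ^ card (even_white T c - {rootv T}) else 0)"

text \<open>The contribution of a subtree hanging from a parent of colour \<open>\<epsilon>\<close>.\<close>

fun branch_weight :: "'b::field \<Rightarrow> nat \<Rightarrow> 'b \<Rightarrow> 'a rooted_graph \<times> ('a \<Rightarrow> nat) \<Rightarrow> 'b" where
  "branch_weight t \<epsilon> \<sigma> (T, c) = \<sigma> ^ c (rootv T) * t ^ card (even_white T c - {rootv T}) *
     (if c (rootv T) = 0 \<and> even (card (black_nbrs T c (rootv T)) + \<epsilon>) then t else 1)"

text \<open>The new edge changes only two neighbourhoods: \<open>r\<close> gains \<open>v\<close> if
  \<open>v\<close> is black, and \<open>v\<close> gains \<open>r\<close> if \<open>r\<close> is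
  black. The first gives the factor \<sigma>, the second the parity shift by \<epsilon>.\<close>

lemma root_weight_join:
  assumes x: "x \<in> colored_trees A r" and y: "y \<in> colored_trees S v" and AS: "A \<inter> S = {}"
    and \<epsilon>: "\<epsilon> \<in> {0, 1}"
  shows "root_weight t \<epsilon> \<sigma> (colored_join x y) = root_weight t \<epsilon> \<sigma> x * branch_weight t \<epsilon> \<sigma> y"
proof -
  obtain T c U d where [simp]: "x = (T, c)" "y = (U, d)" by fastforce
  note D = colored_treesD[OF x[simplified]] and E = colored_treesD[OF y[simplified]]
  note TD = rooted_treeD[OF D(1), unfolded D(2,3)] and UD = rooted_treeD[OF E(1), unfolded E(2,3)]
  let ?J = "join T U" and ?e = "\<lambda>x. if x \<in> verts U then d x else c x"
  have rv: "r \<notin> S" "v \<notin> A" using AS D(5) E(5) by auto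
  have b1: "black_nbrs ?J ?e u = black_nbrs T c u" if "u \<in> A" "u \<noteq> r" for u
    using that TD(3) UD(3) AS rv D(2,3) E(2,3) by (auto simp: black_nbrs_def)
  have b2: "black_nbrs ?J ?e u = black_nbrs U d u" if "u \<in> S" "u \<noteq> v" for u
    using that TD(3) UD(3) AS rv D(2,3) E(2,3) by (auto simp: black_nbrs_def)
  have b3: "black_nbrs ?J ?e r = black_nbrs T c r \<union> (if d v = 1 then {v} else {})"
    using TD(3) UD(3) AS rv D(2,3,5) E(2,3,5) by (auto simp: black_nbrs_def)
  have b4: "black_nbrs ?J ?e v = black_nbrs U d v \<union> (if c r = 1 then {r} else {})"
    using TD(3) UD(3) AS rv D(2,3,5) E(2,3,5) by (auto simp: black_nbrs_def)
  have fin: "finite (black_nbrs T c r)" "finite (black_nbrs U d v)"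
    using TD(1) UD(1) D(2) E(2) by (auto simp: black_nbrs_def)
  have nin: "v \<notin> black_nbrs T c r" "r \<notin> black_nbrs U d v"
    using rv D(2) E(2) by (auto simp: black_nbrs_def)
  have c3: "card (black_nbrs ?J ?e r) = card (black_nbrs T c r) + d v"
    using fin nin E(6) unfolding b3 by auto
  have c4: "card (black_nbrs ?J ?e v) = card (black_nbrs U d v) + c r"
    using fin nin D(6) unfolding b4 by auto
  \<comment> \<open>Unlike \<open>r\<close>, the vertex \<open>v\<close> is no root in the join and
    must be counted; \<open>B\<close> records whether it is even-white there.\<close>
  define B where "B = (if d v = 0 \<and> even (card (black_nbrs U d v) + c r) then {v} else {})"
  have mem: "w \<in> even_white ?J ?e - {r} \<longleftrightarrow>
      w \<in> (even_white T c - {r}) \<union> (even_white U d - {v}) \<union> B" for w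
  proof -
    consider "w = r" | "w = v" | "w \<in> A" "w \<noteq> r" | "w \<in> S" "w \<noteq> v" | "w \<notin> A \<union> S" by blast
    then show ?thesis
    proof cases
      case 1 then show ?thesis using rv E by (auto simp: B_def even_white_def)
    next
      case 2 then show ?thesis using rv D E c4 by (auto simp: B_def even_white_def)
    next
      case 3 then show ?thesis using rv D E b1[of w] AS by (auto simp: B_def even_white_def)
    next
      case 4 then show ?thesis using rv D E b2[of w] AS by (auto simp: B_def even_white_def)
    next
      case 5 then show ?thesis using D E by (auto simp: B_def even_white_def)
    qed
  qed
  have f: "finite (even_white T c)" "finite (even_white U d)"
    "even_white T c \<subseteq> A" "even_white U d \<subseteq> S"
    using TD(1) UD(1) D(2) E(2) by (auto simp: even_white_def)
  have "card (even_white ?J ?e - {r}) =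
      card ((even_white T c - {r}) \<union> (even_white U d - {v}) \<union> B)"
    using mem by (intro arg_cong[of _ _ card] set_eqI) blast
  also have "\<dots> = card (even_white T c - {r}) + card (even_white U d - {v}) + card B"
    using f AS rv by (subst card_Un_disjoint; (subst card_Un_disjoint)?) (auto simp: B_def)
  finally have ew: "card (even_white ?J ?e - {r}) =
      card (even_white T c - {r}) + card (even_white U d - {v}) + card B" .
  have er: "r \<notin> verts U" using rv E(2) by simp
  show ?thesis
  proof (cases "c r = \<epsilon>")
    case True
    have bw: "branch_weight t \<epsilon> \<sigma> y =
        \<sigma> ^ d v * t ^ card (even_white U d - {v}) * t ^ card B"
      by (simp add: E(3) B_def True)
    have rw: "root_weight t \<epsilon> \<sigma> x =
        \<sigma> ^ card (black_nbrs T c r) * t ^ card (even_white T c - {r})"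
      by (simp add: D(3) True)
    have "root_weight t \<epsilon> \<sigma> (colored_join x y) =
        \<sigma> ^ (card (black_nbrs T c r) + d v) *
        t ^ (card (even_white T c - {r}) + card (even_white U d - {v}) + card B)"
      using er True by (simp add: D(3) c3 ew)
    also have "\<dots> = root_weight t \<epsilon> \<sigma> x * branch_weight t \<epsilon> \<sigma> y"
      unfolding bw rw by (simp only: power_add mult_ac)
    finally show ?thesis .
  next
    case False
    then show ?thesis using D(3) er by simp
  qed
qed

text \<open>For a white root, (1 + t) / 2 plus or minus (t - 1) / 2 interpolates between t and 1
  according to the parity; a black parent swaps the two values, hence the sign given by
  \<epsilon>.\<close>

lemma branch_weight_eq:
  fixes t :: "'b::field_char_0"
  assumes "x \<in> colored_trees A r" "\<epsilon> \<in> {0, 1}"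
  shows "branch_weight t \<epsilon> \<sigma> x = ((1 + t) * root_weight t 0 1 x +
    (- 1) ^ \<epsilon> * (t - 1) * root_weight t 0 (- 1) x + 2 * \<sigma> * root_weight t 1 1 x) / 2"
proof -
  obtain T c where [simp]: "x = (T, c)" by fastforce
  note D = colored_treesD[OF assms(1)[simplified]]
  show ?thesis
    using D(3,6) assms(2)
    by (cases "even (card (black_nbrs T c r))") (auto simp: field_simps)
qed

lemma colored_trees_singleton:
  "colored_trees {r} r = (\<lambda>k. (\<lparr>verts = {r}, adj = {}, rootv = r\<rparr>, \<lambda>x\<in>{r}. k)) ` {0, 1}"
    (is "_ = ?f ` _")
proof
  show "colored_trees {r} r \<subseteq> ?f ` {0, 1}"
  proof (rule subrelI)
    fix T c assume *: "(T, c) \<in> colored_trees {r} r"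
    note D = colored_treesD[OF *]
    have "adj T = {}" using rooted_treeD(3,5)[OF D(1)] D(2) by (auto simp: irrefl_def)
    then have "T = \<lparr>verts = {r}, adj = {}, rootv = r\<rparr>" using D by simp
    moreover have "c = (\<lambda>x\<in>{r}. c r)" using PiE_arb[OF D(4)] by (auto simp: fun_eq_iff)
    ultimately show "(T, c) \<in> ?f ` {0, 1}"
      using D(6) by (intro image_eqI[of _ _ "c r"]) (auto simp only:)
  qed
  have "\<not> graph_cycle {} p" for p :: "'a list"
    by (cases p) (auto simp: graph_cycle_def)
  then show "?f ` {0, 1} \<subseteq> colored_trees {r} r"
    by (auto simp: colored_trees_def colorings_def rooted_tree_def sym_def irrefl_def)
qed

lemma even_white_singleton_root: "even_white \<lparr>verts = {r}, adj = {}, rootv = r\<rparr> c - {r} = {}"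
  by (auto simp: even_white_def)

section \<open>Recursion for the weighted sums with a fixed root\<close>

definition root_sum :: "'b::field \<Rightarrow> nat \<Rightarrow> 'b \<Rightarrow> 'a set \<Rightarrow> 'a \<Rightarrow> 'b" where
  "root_sum t \<epsilon> \<sigma> A r = (\<Sum>x\<in>colored_trees A r. root_weight t \<epsilon> \<sigma> x)"

definition branch_sum :: "'b::field \<Rightarrow> nat \<Rightarrow> 'b \<Rightarrow> 'a set \<Rightarrow> 'b" where
  "branch_sum t \<epsilon> \<sigma> S = (\<Sum>v\<in>S. \<Sum>y\<in>colored_trees S v. branch_weight t \<epsilon> \<sigma> y)"

lemma root_sum_singleton:
  assumes "\<epsilon> \<in> {0, 1}"
  shows "root_sum t \<epsilon> \<sigma> {r} r = 1"
proof -
  have inj: "inj_on (\<lambda>k::nat. (\<lparr>verts = {r}, adj = {}, rootv = r\<rparr>, \<lambda>x\<in>{r}. k)) {0, 1}"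
    by (auto simp: inj_on_def dest: fun_cong[of _ _ r])
  have "black_nbrs \<lparr>verts = {r}, adj = {}, rootv = r\<rparr> c u = {}" for c u
    by (auto simp: black_nbrs_def)
  then show ?thesis
    using assms unfolding root_sum_def colored_trees_singleton sum.reindex[OF inj]
    by (auto simp: even_white_singleton_root)
qed

text \<open>Multiplicativity turns the sum over cuts into a convolution. Taking \<open>m\<close> out
  of \<open>S\<close> leaves a full power set as index set, from which the binomial coefficients
  will come.\<close>

lemma root_sum_rec:
  assumes "finite A" "r \<in> A" "m \<in> A" "m \<noteq> r" "\<epsilon> \<in> {0, 1}"
  shows "root_sum t \<epsilon> \<sigma> A r = (\<Sum>S\<in>Pow (A - {r, m}).
    branch_sum t \<epsilon> \<sigma> (insert m S) * root_sum t \<epsilon> \<sigma> (A - insert m S) r)"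
proof -
  have "root_sum t \<epsilon> \<sigma> A r = (\<Sum>S\<in>{S. S \<subseteq> A - {r} \<and> m \<in> S}. \<Sum>v\<in>S.
      \<Sum>x\<in>colored_trees (A - S) r. \<Sum>y\<in>colored_trees S v.
        root_weight t \<epsilon> \<sigma> (colored_join x y))"
    unfolding root_sum_def using assms by (intro sum_colored_trees_split)
  also have "\<dots> = (\<Sum>S\<in>{S. S \<subseteq> A - {r} \<and> m \<in> S}. \<Sum>v\<in>S.
      \<Sum>x\<in>colored_trees (A - S) r. \<Sum>y\<in>colored_trees S v.
        root_weight t \<epsilon> \<sigma> x * branch_weight t \<epsilon> \<sigma> y)"
    using assms(5) by (intro sum.cong refl root_weight_join) auto
  also have "\<dots> = (\<Sum>S\<in>{S. S \<subseteq> A - {r} \<and> m \<in> S}.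
      branch_sum t \<epsilon> \<sigma> S * root_sum t \<epsilon> \<sigma> (A - S) r)"
    unfolding branch_sum_def root_sum_def sum_distrib_right sum_distrib_left
    by (intro sum.cong refl, subst sum.swap) (simp add: mult_ac)
  also have "\<dots> = (\<Sum>S\<in>Pow (A - {r, m}).
      branch_sum t \<epsilon> \<sigma> (insert m S) * root_sum t \<epsilon> \<sigma> (A - insert m S) r)"
    using assms by (intro sum.reindex_bij_witness[of _ "insert m" "\<lambda>S. S - {m}"])
      (auto simp: insert_absorb)
  finally show ?thesis .
qed

text \<open>The index counts the vertices other than the root. Label \<open>n\<close> as root is an
  arbitrary choice, justified by \<open>root_sum_eq_egf_coeff\<close>.\<close>

definition egf_coeff :: "'b::field \<Rightarrow> nat \<Rightarrow> 'b \<Rightarrow> nat \<Rightarrow> 'b" where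
  "egf_coeff t \<epsilon> \<sigma> n = root_sum t \<epsilon> \<sigma> {..n} n"

text \<open>\<open>branch_weight_eq\<close> summed over the colored trees on n + 1 labels with one
  fixed branch root; the choice of that root is counted separately.\<close>

definition branch_coeff :: "'b::field \<Rightarrow> nat \<Rightarrow> 'b \<Rightarrow> nat \<Rightarrow> 'b" where
  "branch_coeff t \<epsilon> \<sigma> n = ((1 + t) * egf_coeff t 0 1 n +
    (- 1) ^ \<epsilon> * (t - 1) * egf_coeff t 0 (- 1) n + 2 * \<sigma> * egf_coeff t 1 1 n) / 2"

text \<open>The right side mentions neither \<open>A\<close> nor \<open>r\<close>, which is what
  makes the sum depend on the size only. The independence for smaller sets is a hypothesis, so that
  the lemma serves both inside that induction and after it.\<close>

lemma root_sum_step: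
  fixes t :: "'b::field_char_0" and A :: "nat set"
  assumes IH: "\<And>k A r \<epsilon> \<sigma>. k \<le> n \<Longrightarrow> finite A \<Longrightarrow> r \<in> A \<Longrightarrow> card A = Suc k \<Longrightarrow> \<epsilon> \<in> {0, 1} \<Longrightarrow>
      root_sum t \<epsilon> \<sigma> (A :: nat set) r = egf_coeff t \<epsilon> \<sigma> k"
    and A: "finite A" "r \<in> A" "card A = Suc (Suc n)" and \<epsilon>: "\<epsilon> \<in> {0, 1}"
  shows "root_sum t \<epsilon> \<sigma> A r = (\<Sum>k\<le>n. of_nat (n choose k) *
    (of_nat (Suc k) * branch_coeff t \<epsilon> \<sigma> k * egf_coeff t \<epsilon> \<sigma> (n - k)))"
proof -
  have "card (A - {r}) = Suc n" using A by simp
  then obtain m where m: "m \<in> A" "m \<noteq> r" by (metis Diff_iff card_gt_0_iff ex_in_conv insertI1 zero_less_Suc)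
  have cB: "card (A - {r, m}) = n" using A m by (simp add: card_Diff_subset)
  have "branch_sum t \<epsilon> \<sigma> (insert m S) * root_sum t \<epsilon> \<sigma> (A - insert m S) r =
      of_nat (Suc (card S)) * branch_coeff t \<epsilon> \<sigma> (card S) * egf_coeff t \<epsilon> \<sigma> (n - card S)"
    if S: "S \<in> Pow (A - {r, m})" for S
  proof -
    have fS: "finite S" "m \<notin> S" "r \<notin> S" "S \<subseteq> A" using S A by (auto intro: finite_subset)
    have cS: "card S \<le> n" using S cB A by (metis PowD card_mono finite_Diff)
    have cI: "card (insert m S) = Suc (card S)" using fS by simp
    have "(\<Sum>y\<in>colored_trees (insert m S) v. branch_weight t \<epsilon> \<sigma> y) =
        branch_coeff t \<epsilon> \<sigma> (card S)" if "v \<in> insert m S" for v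
    proof -
      have "(\<Sum>y\<in>colored_trees (insert m S) v. branch_weight t \<epsilon> \<sigma> y) =
          ((1 + t) * root_sum t 0 1 (insert m S) v +
           (- 1) ^ \<epsilon> * (t - 1) * root_sum t 0 (- 1) (insert m S) v +
           2 * \<sigma> * root_sum t 1 1 (insert m S) v) / 2"
        unfolding root_sum_def sum_distrib_left sum.distrib[symmetric] sum_divide_distrib
        using \<epsilon> by (intro sum.cong refl branch_weight_eq)
      then show ?thesis
        using that fS cI cS by (simp add: IH branch_coeff_def)
    qed
    \<comment> \<open>Each of the \<open>Suc (card S)\<close> vertices of the branch may be its
      root, with equal contribution.\<close>
    then have "branch_sum t \<epsilon> \<sigma> (insert m S) =
        of_nat (Suc (card S)) * branch_coeff t \<epsilon> \<sigma> (card S)"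
      unfolding branch_sum_def using cI by simp
    moreover have "card (A - insert m S) = Suc (n - card S)"
      using fS m A cI cS by (subst card_Diff_subset) auto
    then have "root_sum t \<epsilon> \<sigma> (A - insert m S) r = egf_coeff t \<epsilon> \<sigma> (n - card S)"
      using fS m A \<epsilon> by (intro IH) auto
    ultimately show ?thesis by simp
  qed
  then have "root_sum t \<epsilon> \<sigma> A r = (\<Sum>S\<in>Pow (A - {r, m}).
      of_nat (Suc (card S)) * branch_coeff t \<epsilon> \<sigma> (card S) * egf_coeff t \<epsilon> \<sigma> (n - card S))"
    using A m \<epsilon> by (subst root_sum_rec[of _ _ m]) auto
  also have "\<dots> = (\<Sum>k\<le>n. of_nat (n choose k) *
    (of_nat (Suc k) * branch_coeff t \<epsilon> \<sigma> k * egf_coeff t \<epsilon> \<sigma> (n - k)))"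
    using sum_Pow_card[of "A - {r, m}"
        "\<lambda>k. of_nat (Suc k) * branch_coeff t \<epsilon> \<sigma> k * egf_coeff t \<epsilon> \<sigma> (n - k)"] A cB by simp
  finally show ?thesis .
qed

lemma root_sum_eq_egf_coeff:
  fixes t :: "'b::field_char_0" and A :: "nat set"
  assumes "finite A" "r \<in> A" "card A = Suc n" "\<epsilon> \<in> {0, 1}"
  shows "root_sum t \<epsilon> \<sigma> A r = egf_coeff t \<epsilon> \<sigma> n"
  using assms
proof (induction n arbitrary: A r \<epsilon> \<sigma> rule: less_induct)
  case (less n)
  show ?case
  proof (cases n)
    case 0
    then have "A = {r}" using less.prems by (auto simp: card_Suc_eq)
    then show ?thesis using 0
      by (simp add: egf_coeff_def atMost_0 root_sum_singleton[OF less.prems(4)])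
  next
    case (Suc k)
    have IH: "root_sum t \<epsilon>' \<sigma>' A' r' = egf_coeff t \<epsilon>' \<sigma>' j"
      if "j \<le> k" "finite (A' :: nat set)" "r' \<in> A'" "card A' = Suc j" "\<epsilon>' \<in> {0, 1}"
      for j A' r' \<epsilon>' \<sigma>'
      by (rule less.IH) (use that Suc in auto)
    have "card A = Suc (Suc k)" using less.prems(3) Suc by simp
    then have "root_sum t \<epsilon> \<sigma> A r = (\<Sum>i\<le>k. of_nat (k choose i) *
        (of_nat (Suc i) * branch_coeff t \<epsilon> \<sigma> i * egf_coeff t \<epsilon> \<sigma> (k - i)))"
      using less.prems by (intro root_sum_step IH)
    \<comment> \<open>The same step for the standard label set, read backwards: both sums equal one
      expression in smaller coefficients.\<close>
    also have "\<dots> = root_sum t \<epsilon> \<sigma> {..Suc k} (Suc k)"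
      using less.prems by (intro root_sum_step[symmetric] IH) simp_all
    finally show ?thesis by (simp only: egf_coeff_def Suc)
  qed
qed

lemma egf_coeff_0:
  fixes t :: "'b::field_char_0"
  shows "\<epsilon> \<in> {0, 1} \<Longrightarrow> egf_coeff t \<epsilon> \<sigma> 0 = 1"
  by (simp add: egf_coeff_def atMost_0 root_sum_singleton)

lemma egf_coeff_Suc:
  fixes t :: "'b::field_char_0"
  assumes "\<epsilon> \<in> {0, 1}"
  shows "egf_coeff t \<epsilon> \<sigma> (Suc n) = (\<Sum>k\<le>n. of_nat (n choose k) *
    (of_nat (Suc k) * branch_coeff t \<epsilon> \<sigma> k * egf_coeff t \<epsilon> \<sigma> (n - k)))"
proof -
  have "egf_coeff t \<epsilon> \<sigma> (Suc n) = root_sum t \<epsilon> \<sigma> {..Suc n} (Suc n)"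
    by (simp add: egf_coeff_def)
  also have "\<dots> = (\<Sum>k\<le>n. of_nat (n choose k) *
    (of_nat (Suc k) * branch_coeff t \<epsilon> \<sigma> k * egf_coeff t \<epsilon> \<sigma> (n - k)))"
    using assms by (intro root_sum_step root_sum_eq_egf_coeff) auto
  finally show ?thesis .
qed

section \<open>Generating functions\<close>

definition egf :: "'b::field_char_0 \<Rightarrow> nat \<Rightarrow> 'b \<Rightarrow> 'b fps" where
  "egf t \<epsilon> \<sigma> = Abs_fps (\<lambda>n. egf_coeff t \<epsilon> \<sigma> n / fact n)"

text \<open>Averaging over \<sigma> = 1 and \<sigma> = -1 keeps the even case; \<open>fps_X\<close>
  counts the root, and t is the root's own factor, which \<open>root_weight\<close> omits.\<close>

definition egf_w_plus :: "'b::field_char_0 \<Rightarrow> 'b fps" where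
  "egf_w_plus t = fps_const (t / 2) * (fps_X * (egf t 0 1 + egf t 0 (- 1)))"

definition egf_w_minus :: "'b::field_char_0 \<Rightarrow> 'b fps" where
  "egf_w_minus t = fps_const (1 / 2) * (fps_X * (egf t 0 1 - egf t 0 (- 1)))"

definition egf_b :: "'b::field_char_0 \<Rightarrow> 'b fps" where
  "egf_b t = fps_X * egf t 1 1"

lemma egf_nth_0 [simp]: "egf_w_plus t $ 0 = 0" "egf_w_minus t $ 0 = 0" "egf_b t $ 0 = 0"
  by (simp_all add: egf_w_plus_def egf_w_minus_def egf_b_def)

lemma egf_eq_Exp_branch:
  fixes t :: "'b::field_char_0"
  assumes "\<epsilon> \<in> {0, 1}"
  shows "egf t \<epsilon> \<sigma> = fps_Exp (fps_X * (fps_const (1 / 2) * (fps_const (1 + t) * egf t 0 1 +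
    fps_const ((- 1) ^ \<epsilon> * (t - 1)) * egf t 0 (- 1) + fps_const (2 * \<sigma>) * egf t 1 1)))"
proof -
  have "Abs_fps (\<lambda>n. branch_coeff t \<epsilon> \<sigma> n / fact n) =
      fps_const (1 / 2) * (fps_const (1 + t) * egf t 0 1 +
        fps_const ((- 1) ^ \<epsilon> * (t - 1)) * egf t 0 (- 1) + fps_const (2 * \<sigma>) * egf t 1 1)"
    by (rule fps_ext) (simp add: branch_coeff_def egf_def field_simps)
  then show ?thesis
    unfolding egf_def using egf_eq_Exp[OF egf_coeff_0[OF assms] egf_coeff_Suc[OF assms]] by metis
qed

text \<open>With E and E' the series at \<sigma> = 1 and \<sigma> = -1, (1 + t) E + (t - 1) E'
  regroups as t (E + E') + (E - E'), which up to the factor \<open>fps_X\<close> / 2 is the sum of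
  the two white series.\<close>

lemma egf_white:
  fixes t :: "'b::field_char_0"
  shows "egf t 0 1 = fps_Exp (egf_w_plus t + egf_w_minus t + egf_b t)"
    and "egf t 0 (- 1) = fps_Exp (egf_w_plus t + egf_w_minus t - egf_b t)"
  by (subst egf_eq_Exp_branch, simp, rule arg_cong[of _ _ fps_Exp], rule fps_ext,
      simp add: egf_w_plus_def egf_w_minus_def egf_b_def field_simps)+

text \<open>Below a black parent the coefficient of E' changes sign, and the regrouping is (E + E')
  + t (E - E'): the factor t moves from the even to the odd series.\<close>

lemma egf_black:
  fixes t :: "'b::field_char_0"
  assumes "t \<noteq> 0"
  shows "egf t 1 1 =
    fps_Exp (fps_const (inverse t) * egf_w_plus t + fps_const t * egf_w_minus t + egf_b t)"
  using assms
  by (subst egf_eq_Exp_branch, simp, intro arg_cong[of _ _ fps_Exp] fps_ext,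
      simp add: egf_w_plus_def egf_w_minus_def egf_b_def field_simps)

lemma egf_fixed_point:
  fixes t :: "'b::field_char_0"
  shows "egf_w_plus t =
      fps_const t * fps_X * fps_Exp (egf_w_plus t + egf_w_minus t) * fps_Cosh (egf_b t)"
    and "egf_w_minus t = fps_X * fps_Exp (egf_w_plus t + egf_w_minus t) * fps_Sinh (egf_b t)"
    and "t \<noteq> 0 \<Longrightarrow> egf_b t = fps_X *
      fps_Exp (fps_const (inverse t) * egf_w_plus t + fps_const t * egf_w_minus t + egf_b t)"
proof -
  have "fps_const t * fps_X * fps_Exp (egf_w_plus t + egf_w_minus t) * fps_Cosh (egf_b t) =
      fps_const t * fps_X * (fps_const (1 / 2) * (egf t 0 1 + egf t 0 (- 1)))"
    unfolding egf_white mult.assoc by (subst fps_Exp_mult_Cosh) simp_all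
  also have "\<dots> = fps_const (t * (1 / 2)) * (fps_X * (egf t 0 1 + egf t 0 (- 1)))"
    unfolding fps_const_mult[symmetric] by (simp only: mult_ac)
  finally show "egf_w_plus t =
      fps_const t * fps_X * fps_Exp (egf_w_plus t + egf_w_minus t) * fps_Cosh (egf_b t)"
    by (simp add: egf_w_plus_def)
  have "fps_X * fps_Exp (egf_w_plus t + egf_w_minus t) * fps_Sinh (egf_b t) =
      fps_X * (fps_const (1 / 2) * (egf t 0 1 - egf t 0 (- 1)))"
    unfolding egf_white mult.assoc by (subst fps_Exp_mult_Sinh) simp_all
  then show "egf_w_minus t =
      fps_X * fps_Exp (egf_w_plus t + egf_w_minus t) * fps_Sinh (egf_b t)"
    by (simp only: egf_w_minus_def mult_ac)
  show "egf_b t = fps_X *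
      fps_Exp (fps_const (inverse t) * egf_w_plus t + fps_const t * egf_w_minus t + egf_b t)"
    if "t \<noteq> 0"
    using egf_black[OF that] by (simp add: egf_b_def)
qed

section \<open>From labelled sums over the fraction field back to the tree series\<close>

lemma tvar_nonzero: "tvar \<noteq> 0"
  by (simp add: tvar_def)

lemma to_fract_power: "to_fract (p ^ n) = to_fract p ^ n"
  by (induction n) simp_all

lemma to_fract_coloring_weight:
  "to_fract (coloring_weight T c) = tvar ^ card (even_white T c)"
proof -
  have "coloring_weight T c = monom 1 1 ^ card (even_white T c)"
    by (simp add: coloring_weight_def monom_power)
  then show ?thesis by (simp add: tvar_def to_fract_power)
qed

lemma to_fract_of_nat: "to_fract (of_nat n) = of_nat n"
  by (induction n) simp_all

text \<open>\<open>Q\<close> leaves the condition at the root open, so that one statement covers all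
  four series; the labelled trees are then grouped by their root.\<close>

lemma to_fract_tree_sum_nth:
  fixes Q :: "nat \<Rightarrow> nat \<Rightarrow> bool"
  defines "f \<equiv> \<lambda>T :: nat rooted_graph.
    \<Sum>c\<in>{c \<in> colorings T. Q (c (rootv T)) (card (black_nbrs T c (rootv T)))}. coloring_weight T c"
  shows "of_nat (fact n) * to_fract (tree_sum f $ n) =
    (\<Sum>r<n. \<Sum>(T, c)\<in>colored_trees {..<n} r.
       if Q (c (rootv T)) (card (black_nbrs T c (rootv T))) then tvar ^ card (even_white T c) else 0)"
    (is "_ = (\<Sum>r<n. sum ?F (?C r))")
proof -
  have fin: "finite (colorings T)" if "T \<in> rooted_trees n" for T
    using that by (auto simp: colorings_def rooted_trees_def intro!: finite_PiE)
  have f_eq: "f T = (\<Sum>c\<in>colorings T. if Q (c (rootv T)) (card (black_nbrs T c (rootv T)))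
      then monom 1 (card (even_white T c)) else 0)" if "T \<in> rooted_trees n" for T
    unfolding f_def coloring_weight_def by (rule sum.inter_filter[OF fin[OF that]])
  have "f S = f T" if "S \<in> rooted_trees n" "T \<in> rooted_trees n" "rooted_iso h S T" for S T h
  proof -
    have "rootv S \<in> verts S" using that(1) unfolding rooted_trees_def rooted_tree_def by blast
    then show ?thesis
      unfolding f_eq[OF that(1)] f_eq[OF that(2)]
      using sum_colorings_iso[OF that(3), of "\<lambda>a b k. if Q a b then monom 1 k else 0"] by simp
  qed
  then have "of_nat (fact n) * tree_sum f $ n = (\<Sum>T\<in>rooted_trees n. f T)"
    by (rule tree_sum_nth)
  then have "to_fract (of_nat (fact n) * tree_sum f $ n) = to_fract (\<Sum>T\<in>rooted_trees n. f T)"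
    by (rule arg_cong)
  then have "of_nat (fact n) * to_fract (tree_sum f $ n) =
      (\<Sum>T\<in>rooted_trees n. to_fract (f T))"
    by (simp only: to_fract_mult to_fract_of_nat to_fract_sum)
  also have "\<dots> = (\<Sum>T\<in>rooted_trees n. \<Sum>c\<in>colorings T. ?F (T, c))"
    unfolding f_def to_fract_sum to_fract_coloring_weight prod.case
    by (intro sum.cong refl sum.inter_filter fin)
  also have "\<dots> = sum ?F (SIGMA T:rooted_trees n. colorings T)"
    using finite_rooted_trees fin by (subst sum.Sigma) auto
  also have "(SIGMA T:rooted_trees n. colorings T) = (\<Union>r<n. ?C r)"
    by (auto simp: colored_trees_def rooted_trees_def rooted_tree_def)
  also have "sum ?F \<dots> = (\<Sum>r<n. sum ?F (?C r))"
    by (intro sum.UNION_disjoint) (auto intro: finite_colored_trees dest: colored_treesD(3))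
  finally show ?thesis .
qed

text \<open>All n roots contribute the same coefficient of index n - 1, and n / n! = 1 / (n -
  1)!.\<close>

lemma sum_root_sum:
  fixes t :: "'b::field_char_0"
  assumes "\<epsilon> \<in> {0, 1}"
  shows "(\<Sum>r<n. root_sum t \<epsilon> \<sigma> {..<n} r) = fact n * (fps_X * egf t \<epsilon> \<sigma>) $ n"
proof (cases n)
  case (Suc m)
  then have "(\<Sum>r<n. root_sum t \<epsilon> \<sigma> {..<n} r) = (\<Sum>r<n. egf_coeff t \<epsilon> \<sigma> m)"
    using assms by (intro sum.cong refl root_sum_eq_egf_coeff) auto
  then show ?thesis using Suc by (simp add: egf_def del: of_nat_Suc)
qed simp

text \<open>An even-white root contributes the factor t missing from \<open>root_weight\<close>; any
  other root does not affect the count.\<close>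

lemma colored_tree_weight:
  fixes t :: "'b::field_char_0"
  assumes "(T, c) \<in> colored_trees A r"
  shows "(if c (rootv T) = 0 \<and> even (card (black_nbrs T c (rootv T)))
      then t ^ card (even_white T c) else 0) =
      t / 2 * (root_weight t 0 1 (T, c) + root_weight t 0 (- 1) (T, c))"
    and "(if c (rootv T) = 0 \<and> odd (card (black_nbrs T c (rootv T)))
      then t ^ card (even_white T c) else 0) =
      1 / 2 * (root_weight t 0 1 (T, c) - root_weight t 0 (- 1) (T, c))"
    and "(if c (rootv T) = 1 then t ^ card (even_white T c) else 0) = root_weight t 1 1 (T, c)"
proof -
  note D = colored_treesD[OF assms]
  have fin: "finite (even_white T c)"
    using rooted_treeD(1)[OF D(1)] by (simp add: even_white_def)
  show "(if c (rootv T) = 0 \<and> even (card (black_nbrs T c (rootv T)))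
      then t ^ card (even_white T c) else 0) =
      t / 2 * (root_weight t 0 1 (T, c) + root_weight t 0 (- 1) (T, c))"
  proof (cases "c r = 0 \<and> even (card (black_nbrs T c r))")
    case True
    then have "r \<in> even_white T c" using D by (simp add: even_white_def)
    then have "card (even_white T c) = Suc (card (even_white T c - {r}))"
      using fin by (metis card.remove)
    then show ?thesis using True D(3) by simp
  next
    case False
    then show ?thesis using D(3) by auto
  qed
  have *: "even_white T c - {r} = even_white T c"
    if "c r \<noteq> 0 \<or> odd (card (black_nbrs T c r))"
    using that by (auto simp: even_white_def)
  show "(if c (rootv T) = 0 \<and> odd (card (black_nbrs T c (rootv T)))
      then t ^ card (even_white T c) else 0) =
      1 / 2 * (root_weight t 0 1 (T, c) - root_weight t 0 (- 1) (T, c))"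
    using * D(3) by auto
  show "(if c (rootv T) = 1 then t ^ card (even_white T c) else 0) = root_weight t 1 1 (T, c)"
    using * D(3) by auto
qed

lemma to_fract_tree_series_w_plus: "to_fract (tree_series_w_plus $ n) = egf_w_plus tvar $ n"
proof -
  have "of_nat (fact n) * to_fract (tree_series_w_plus $ n) =
      (\<Sum>r<n. \<Sum>x\<in>colored_trees {..<n} r.
        tvar / 2 * (root_weight tvar 0 1 x + root_weight tvar 0 (- 1) x))"
    unfolding tree_series_w_plus_def to_fract_tree_sum_nth[of n "\<lambda>a b. a = 0 \<and> even b"]
    by (intro sum.cong refl) (auto simp only: prod.case colored_tree_weight(1) split: prod.split)
  also have "\<dots> = tvar / 2 * ((\<Sum>r<n. root_sum tvar 0 1 {..<n} r) +
      (\<Sum>r<n. root_sum tvar 0 (- 1) {..<n} r))"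
    by (simp only: root_sum_def flip: sum.distrib sum_distrib_left)
  also have "\<dots> = fact n * egf_w_plus tvar $ n"
    by (simp add: sum_root_sum egf_w_plus_def algebra_simps)
  finally show ?thesis by simp
qed

lemma to_fract_tree_series_w_minus: "to_fract (tree_series_w_minus $ n) = egf_w_minus tvar $ n"
proof -
  have "of_nat (fact n) * to_fract (tree_series_w_minus $ n) =
      (\<Sum>r<n. \<Sum>x\<in>colored_trees {..<n} r.
        1 / 2 * (root_weight tvar 0 1 x - root_weight tvar 0 (- 1) x))"
    unfolding tree_series_w_minus_def to_fract_tree_sum_nth[of n "\<lambda>a b. a = 0 \<and> odd b"]
    by (intro sum.cong refl) (auto simp only: prod.case colored_tree_weight(2) split: prod.split)
  also have "\<dots> = 1 / 2 * ((\<Sum>r<n. root_sum tvar 0 1 {..<n} r) -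
      (\<Sum>r<n. root_sum tvar 0 (- 1) {..<n} r))"
    by (simp only: root_sum_def sum_subtractf sum_distrib_left[symmetric])
  also have "\<dots> = fact n * egf_w_minus tvar $ n"
    by (simp add: sum_root_sum egf_w_minus_def algebra_simps)
  finally show ?thesis by simp
qed

lemma to_fract_tree_series_b: "to_fract (tree_series_b $ n) = egf_b tvar $ n"
proof -
  have "of_nat (fact n) * to_fract (tree_series_b $ n) =
      (\<Sum>r<n. \<Sum>x\<in>colored_trees {..<n} r. root_weight tvar 1 1 x)"
    unfolding tree_series_b_def to_fract_tree_sum_nth[of n "\<lambda>a b. a = 1"]
    by (intro sum.cong refl) (auto simp only: prod.case colored_tree_weight(3) split: prod.split)
  also have "\<dots> = fact n * egf_b tvar $ n"
    by (simp add: sum_root_sum egf_b_def flip: root_sum_def)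
  finally show ?thesis by simp
qed

text \<open>The three conditions at the root partition the colorings. The comparison takes place
  after the injective map \<open>to_fract\<close> and multiplication by n!.\<close>

lemma tree_series_eq: "tree_series = tree_series_w_plus + tree_series_w_minus + tree_series_b"
proof (rule fps_ext)
  fix n
  let ?F = "\<lambda>Q (T, c). if Q (c (rootv T)) (card (black_nbrs T c (rootv T)))
    then tvar ^ card (even_white T c) else 0"
  have "of_nat (fact n) * to_fract (tree_series $ n) =
      (\<Sum>r<n. \<Sum>x\<in>colored_trees {..<n} r. ?F (\<lambda>_ _. True) x)"
    using to_fract_tree_sum_nth[of n "\<lambda>_ _. True"]
    by (simp add: tree_series_def bw_poly_def[abs_def])
  also have "\<dots> = (\<Sum>r<n. \<Sum>x\<in>colored_trees {..<n} r.
      ?F (\<lambda>a b. a = 0 \<and> even b) x + ?F (\<lambda>a b. a = 0 \<and> odd b) x + ?F (\<lambda>a b. a = 1) x)"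
  proof (intro sum.cong refl)
    fix r x assume x: "x \<in> colored_trees {..<n} r"
    obtain T c where [simp]: "x = (T, c)" by fastforce
    have "c (rootv T) \<in> {0, 1}" using colored_treesD(3,6)[OF x[simplified]] by simp
    then show "?F (\<lambda>_ _. True) x =
        ?F (\<lambda>a b. a = 0 \<and> even b) x + ?F (\<lambda>a b. a = 0 \<and> odd b) x + ?F (\<lambda>a b. a = 1) x"
      by auto
  qed
  also have "\<dots> = of_nat (fact n) * to_fract (tree_series_w_plus $ n) +
      of_nat (fact n) * to_fract (tree_series_w_minus $ n) +
      of_nat (fact n) * to_fract (tree_series_b $ n)"
    unfolding tree_series_w_plus_def tree_series_w_minus_def tree_series_b_def
      to_fract_tree_sum_nth[of n "\<lambda>a b. a = 0 \<and> even b"]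
      to_fract_tree_sum_nth[of n "\<lambda>a b. a = 0 \<and> odd b"]
      to_fract_tree_sum_nth[of n "\<lambda>a b. a = 1"]
    by (simp only: sum.distrib)
  also have "\<dots> = of_nat (fact n) *
      to_fract ((tree_series_w_plus + tree_series_w_minus + tree_series_b) $ n)"
    by (simp add: algebra_simps)
  finally show "tree_series $ n = (tree_series_w_plus + tree_series_w_minus + tree_series_b) $ n"
    by (simp del: fps_add_nth)
qed

theorem theorem4p7:
  fixes a b c :: "nat \<Rightarrow> rat poly fract fps"
  assumes a_0: "a 0 = fps_const tvar * fps_X"
    and b_0: "b 0 = fps_X ^ 2"
    and c_0: "c 0 = fps_X"
    and a_step: "\<And>i. i > 0 \<Longrightarrow>
      a i = fps_const tvar * fps_X * fps_Exp (a (i - 1) + b (i - 1)) * fps_Cosh (c (i - 1))"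
    and b_step: "\<And>i. i > 0 \<Longrightarrow>
      b i = fps_X * fps_Exp (a (i - 1) + b (i - 1)) * fps_Sinh (c (i - 1))"
    and c_step: "\<And>i. i > 0 \<Longrightarrow>
      c i = fps_X * fps_Exp (fps_const (inverse tvar) * a (i - 1)
              + fps_const tvar * b (i - 1) + c (i - 1))"
  shows "\<exists>a_inf b_inf c_inf :: rat poly fps.
    (\<forall>n. \<forall>\<^sub>F i in sequentially. fps_nth (a i) n = to_fract (fps_nth a_inf n)) \<and>
    (\<forall>n. \<forall>\<^sub>F i in sequentially. fps_nth (b i) n = to_fract (fps_nth b_inf n)) \<and>
    (\<forall>n. \<forall>\<^sub>F i in sequentially. fps_nth (c i) n = to_fract (fps_nth c_inf n)) \<and>
    tree_series_w_plus = a_inf \<and>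
    tree_series_w_minus = b_inf \<and>
    tree_series_b = c_inf \<and>
    tree_series = a_inf + b_inf + c_inf"
proof -
  have agree: "fps_agree i (a i) (egf_w_plus tvar) \<and> fps_agree i (b i) (egf_w_minus tvar) \<and>
      fps_agree i (c i) (egf_b tvar)" for i
    using a_step b_step c_step egf_fixed_point[of tvar] tvar_nonzero
    by (intro tree_recursion_converges) auto
  \<comment> \<open>Agreement below order \<open>i\<close> fixes coefficient n from i = n + 1
    on.\<close>
  have ev: "\<forall>n. \<forall>\<^sub>F i in sequentially. f i $ n = F $ n" if "\<And>i. fps_agree i (f i) F"
    for f :: "nat \<Rightarrow> rat poly fract fps" and F
    using that unfolding fps_agree_def eventually_sequentially by (metis Suc_le_eq)
  have "\<forall>n. \<forall>\<^sub>F i in sequentially. a i $ n = to_fract (tree_series_w_plus $ n)"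
    "\<forall>n. \<forall>\<^sub>F i in sequentially. b i $ n = to_fract (tree_series_w_minus $ n)"
    "\<forall>n. \<forall>\<^sub>F i in sequentially. c i $ n = to_fract (tree_series_b $ n)"
    unfolding to_fract_tree_series_w_plus to_fract_tree_series_w_minus to_fract_tree_series_b
    using agree by (intro ev; blast)+
  \<comment> \<open>The witnesses are the tree series themselves, so the limits have polynomial
    coefficients although the recursion divides by t.\<close>
  then show ?thesis using tree_series_eq by blast
qed

end
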